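(* Let $\mathcal{X}$, $\mathcal{Y}$ and $\mathcal{Z}$ be subspaces of $\mathcal{H}$ with $\dim \mathcal{X} = \dim \mathcal{Y}$. Then $$|\sin\Theta(\mathcal{X},\mathcal{Z})-\sin\Theta(\mathcal{Y},\mathcal{Z})| \prec_w \sin\Theta(\mathcal{X},\mathcal{Y})$$ and $$|\cos\Theta(\mathcal{X},\mathcal{Z})-\cos\Theta(\mathcal{Y},\mathcal{Z})| \prec_w \sin\Theta(\mathcal{X},\mathcal{Y}).$$
   Context: $\mathcal{H}$ is a real or complex vector space of finite dimension $n$ equipped with an inner product. $P_{\mathcal{X}}$ denotes the orthogonal projector onto a subspace $\mathcal{X}$ of $\mathcal{H}$. For an operator $A:\mathcal{H}\to\mathcal{H}$, $s_1(A)\ge s_2(A)\ge\cdots$ are its singular values in nonincreasing order. Principal angles: for subspaces $\mathcal{X},\mathcal{Y}$ of $\mathcal{H}$ let $m=\min\{\dim\mathcal{X},\dim\mathcal{Y}\}$. The vector of principal angles $\Theta(\mathcal{X},\mathcal{Y})=[\theta_1,\ldots,\theta_m]$, $\theta_i\in[0,\pi/2]$, in nondecreasing order, is defined by $\cos\Theta(\mathcal{X},\mathcal{Y})=[s_1(P_{\mathcal{X}}P_{\mathcal{Y}}),\ldots,s_m(P_{\mathcal{X}}P_{\mathcal{Y}})]$. Functions of $\Theta$ (such as $\sin$, $\cos$) and the absolute value $|\cdot|$ of a vector are applied componentwise, and differences are taken componentwise (with the components in the given order). Weak majorization: for a real vector $x=[x_1,\ldots,x_n]$, $x^\downarrow$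 is the vector obtained by rearranging the entries of $x$ in nonincreasing order. For real vectors $x,y$ of length $n$, $x\prec_w y$ means $\sum_{i=1}^k x_i^\downarrow\le\sum_{i=1}^k y_i^\downarrow$ for all $k=1,\ldots,n$. Vectors of different lengths are compared by appending zeros to the shorter one to make the lengths equal. *)

theory Defs
  imports Complex_Main "HOL-Library.Multiset"
begin

text \<open>
  The scalar field: real or complex numbers. In a real normed field the axioms below leave no other
  possibility, see \<open>rc_scalar_cases\<close>; for the reals the conjugation is the identity.
\<close>

class rc_scalar = real_normed_field +
  fixes conjg :: "'a \<Rightarrow> 'a"
  assumes conjg_add: "conjg (x + y) = conjg x + conjg y"
    and conjg_mult: "conjg (x * y) = conjg x * conjg y"
    and conjg_conjg: "conjg (conjg x) = x"
    and mult_conjg_scaleR: "x * conjg x = (norm x)\<^sup>2 *\<^sub>R 1"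

lemma mult_conjg: "x * conjg x = (of_real ((norm x)\<^sup>2) :: 'a :: rc_scalar)"
  by (simp only: mult_conjg_scaleR of_real_def)

instantiation real :: rc_scalar
begin
definition conjg_real :: "real \<Rightarrow> real" where "conjg_real x = x"
instance by standard (auto simp: conjg_real_def power2_eq_square)
end

instantiation complex :: rc_scalar
begin
definition conjg_complex :: "complex \<Rightarrow> complex" where "conjg_complex = cnj"
instance
proof
  fix x y :: complex
  show "x * conjg x = (norm x)\<^sup>2 *\<^sub>R 1"
    unfolding conjg_complex_def scaleR_conv_of_real using complex_norm_square[of x] by simp
qed (simp_all add: conjg_complex_def)
end

lemma conjg_fixed_Reals:
  assumes "conjg x = (x :: 'a :: rc_scalar)"
  shows "x \<in> \<real>"
proof -
  have "x * x = of_real (norm x) * of_real (norm x)"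
    using mult_conjg[of x] assms by (simp add: power2_eq_square)
  then have "x = of_real (norm x) \<or> x = - of_real (norm x)"
    by (simp add: square_eq_iff)
  then show ?thesis
  proof
    assume "x = of_real (norm x)"
    then show ?thesis unfolding Reals_def by (rule range_eqI)
  next
    assume "x = - of_real (norm x)"
    then have "x = of_real (- norm x)" by simp
    then show ?thesis unfolding Reals_def by (rule range_eqI)
  qed
qed

lemma conjg_of_real: "conjg (of_real r :: 'a :: rc_scalar) = of_real r"
proof (cases "r = 0")
  case True
  have "conjg (0 :: 'a) = 0" using conjg_add[of 0 "0 :: 'a"] by simp
  then show ?thesis using True by simp
next
  case False
  have "of_real r * conjg (of_real r) = (of_real r * of_real r :: 'a)"
    by (simp add: mult_conjg power2_eq_square flip: of_real_mult)
  then show ?thesis using False by simp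
qed

lemma rc_scalar_cases:
  "(\<forall>x :: 'a :: rc_scalar. x \<in> \<real> \<and> conjg x = x) \<or>
   (\<exists>i :: 'a. i * i = -1 \<and> conjg i = -i \<and> (\<forall>x. \<exists>a b. x = of_real a + of_real b * i))"
proof (cases "\<forall>x :: 'a. conjg x = x")
  case True
  then show ?thesis using conjg_fixed_Reals by blast
next
  case False
  then obtain z :: 'a where z: "conjg z \<noteq> z" by blast
  have minus: "conjg (- x) = - conjg x" for x :: 'a
    using conjg_mult[of "-1" x] conjg_of_real[of "-1", where 'a = 'a] by simp
  have diff: "conjg (x - y) = conjg x - conjg y" for x y :: 'a
    using conjg_add[of x "- y"] minus[of y] by simp
  define w where "w = z - conjg z"
  define i where "i = w * of_real (1 / norm w)"
  have w: "w \<noteq> 0" "conjg w = - w"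
    using z by (auto simp: w_def diff conjg_conjg)
  have ci: "conjg i = - i"
    by (simp add: i_def conjg_mult conjg_of_real w del: of_real_divide)
  have ni: "norm i = 1"
    using w by (simp add: i_def norm_mult norm_divide)
  have ii: "i * i = -1"
  proof -
    have "- (i * i) = 1" using mult_conjg[of i] by (simp add: ci ni)
    then show ?thesis by (metis minus_minus)
  qed
  have "\<exists>a b. x = of_real a + of_real b * i" for x
  proof -
    have "conjg (x + conjg x) = x + conjg x"
      by (simp add: conjg_add conjg_conjg add.commute)
    then obtain a where a: "x + conjg x = of_real a"
      by (meson conjg_fixed_Reals Reals_cases)
    have "conjg ((x - conjg x) * i) = (x - conjg x) * i"
      by (simp add: conjg_mult diff conjg_conjg ci algebra_simps)
    then obtain b where b: "(x - conjg x) * i = of_real b"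
      by (meson conjg_fixed_Reals Reals_cases)
    have "x - conjg x = - (((x - conjg x) * i) * i)"
      by (simp add: mult.assoc ii)
    then have "x - conjg x = - (of_real b * i)" by (simp add: b)
    moreover have "2 * x = (x + conjg x) + (x - conjg x)" by simp
    ultimately have "2 * x = of_real a - of_real b * i" using a by simp
    then have "x = of_real (a / 2) + of_real (- b / 2) * i"
      by (simp add: field_simps)
    then show ?thesis by blast
  qed
  then show ?thesis using ii ci by blast
qed


locale ip_space = vector_space scale
  for scale :: "'k :: rc_scalar \<Rightarrow> 'v :: ab_group_add \<Rightarrow> 'v" +
  fixes ip :: "'v \<Rightarrow> 'v \<Rightarrow> 'k"
  assumes ip_add_left: "ip (x + y) z = ip x z + ip y z"
    and ip_scale_left: "ip (scale a x) y = a * ip x y"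
    and ip_conjg: "ip y x = conjg (ip x y)"
    and ip_pos: "x \<noteq> 0 \<Longrightarrow> \<exists>r > 0. ip x x = of_real r"
    and finite_dim: "\<exists>B. finite B \<and> span B = UNIV"
begin

definition proj :: "'v set \<Rightarrow> 'v \<Rightarrow> 'v" where
  "proj X v = (THE u. u \<in> X \<and> (\<forall>w \<in> X. ip (v - u) w = 0))"

definition adj :: "('v \<Rightarrow> 'v) \<Rightarrow> 'v \<Rightarrow> 'v" where
  "adj A = (THE B. \<forall>x y. ip (A x) y = ip x (B y))"

text \<open>
  The singular values are the nonnegative square roots of the eigenvalues of \<open>A\<^sup>* A\<close>. As \<open>A\<^sup>* A\<close> is
  self-adjoint, the multiplicity of an eigenvalue is the dimension of its eigenspace.
\<close>

definition sv_mult :: "('v \<Rightarrow> 'v) \<Rightarrow> real \<Rightarrow> nat" where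
  "sv_mult A s = dim {v. adj A (A v) = scale (of_real (s\<^sup>2)) v}"

definition singular_values :: "('v \<Rightarrow> 'v) \<Rightarrow> real list" where
  "singular_values A =
     rev (sorted_list_of_multiset (\<Sum>s \<in> {s. s \<ge> 0 \<and> sv_mult A s > 0}. replicate_mset (sv_mult A s) s))"

definition principal_angles :: "'v set \<Rightarrow> 'v set \<Rightarrow> real list" where
  "principal_angles X Y =
     map arccos (take (min (dim X) (dim Y)) (singular_values (proj X \<circ> proj Y)))"

end


definition pad :: "nat \<Rightarrow> real list \<Rightarrow> real list" where
  "pad n x = x @ replicate (n - length x) 0"

definition desc :: "real list \<Rightarrow> real list" where
  "desc x = rev (sort x)"

definition weakly_majorized :: "real list \<Rightarrow> real list \<Rightarrow> bool" (infix "\<prec>\<^sub>w" 50) where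
  "x \<prec>\<^sub>w y \<longleftrightarrow> (let n = max (length x) (length y) in
     \<forall>k \<in> {1..n}. sum_list (take k (desc (pad n x))) \<le> sum_list (take k (desc (pad n y))))"

text \<open>\<open>map2\<close> truncates to the shorter list; only arguments of equal length are meant.\<close>

definition abs_diff :: "real list \<Rightarrow> real list \<Rightarrow> real list" where
  "abs_diff x y = map2 (\<lambda>a b. \<bar>a - b\<bar>) x y"

end

(*
  For subspaces X and W consider the self-adjoint operator C_X = P_X + P_W - 1. Since C_X^2 agrees
  with P_W P_X P_W on W, the positive eigenvalues of C_X are exactly the nonzero cosines of the
  angles between X and W, and its negative eigenvalues are, up to a shift of the index that depends
  only on dimensions, the same numbers with the opposite sign. Hence a sum of |cos - cos| over an
  index set J is a sum of card J differences of eigenvalues of C_X and C_Y: the indices where X has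
  the larger cosine are taken at the positive end of the spectrum, the others at the negative end.
  By Lidskii's inequality it is at most the sum of the card J largest eigenvalues of
  C_X - C_Y = P_X - P_Y, whose positive eigenvalues are the sines of the angles between X and Y.
  (Mirsky's inequality for the singular values of P_X P_W and P_Y P_W would be too weak, because
  the singular values of P_X - P_Y repeat every sine twice.)
  With W = Z this is the claim for cosines; with W the complement of Z it is the claim for sines.
*)

theory Submission
  imports Defs "HOL-Combinatorics.Permutations"
begin

section \<open>Scalars and orthonormal families\<close>

text \<open>The shift comes from the eigenvalue -1 alone. For 0 < s < 1 the eigenvalues s and -s of
  C_X have equal multiplicity, but the eigenspace for 1 is the intersection of X and W, that for -1
  the intersection of their complements, and these dimensions differ by dim X + dim W - n, where n
  is the dimension of the space. Because dim X = dim Y, the shift is the same for X and Y, so an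
  index read at the negative end still names the same pair of cosines. Cosines that the shift cannot
  reach are equal to 1 for both subspaces and drop out of the difference. The sines on the
  right-hand side need no separate theory: P_X - P_Y = P_X + P_V - 1 with V the complement of Y, an
  operator of the same shape. All spectra are compared by multiplicities: linear maps that are
  injective on an eigenspace bound dimensions from both sides, and a nonincreasing zero-padded
  sequence is recovered from the number of times each positive value occurs.\<close>

lemma conjg_0 [simp]: "conjg (0 :: 'a :: rc_scalar) = 0"
  using conjg_of_real[of 0, where 'a = 'a] by simp

lemma conjg_1 [simp]: "conjg (1 :: 'a :: rc_scalar) = 1"
  using conjg_of_real[of 1, where 'a = 'a] by simp

lemma norm_conjg [simp]: "norm (conjg x) = norm (x :: 'a :: rc_scalar)"
proof -
  have "of_real ((norm (conjg x))\<^sup>2) = (of_real ((norm x)\<^sup>2) :: 'a)"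
    using mult_conjg[of x] mult_conjg[of "conjg x"] by (simp only: conjg_conjg mult.commute)
  then show ?thesis by (simp only: of_real_eq_iff) simp
qed

text \<open>The real part, expressed by polarization because the class offers no projection to the reals.\<close>

definition scal_re :: "'a :: rc_scalar \<Rightarrow> real" where
  "scal_re z = ((norm (1 + z))\<^sup>2 - 1 - (norm z)\<^sup>2) / 2"

lemma of_real_scal_re: "of_real (2 * scal_re z) = z + conjg (z :: 'a :: rc_scalar)"
proof -
  have "of_real (2 * scal_re z) = of_real ((norm (1 + z))\<^sup>2) - 1 - (of_real ((norm z)\<^sup>2) :: 'a)"
    by (simp add: scal_re_def)
  also have "\<dots> = (1 + z) * conjg (1 + z) - 1 - z * conjg z"
    by (simp only: mult_conjg)
  also have "\<dots> = z + conjg z"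
    by (simp add: conjg_add algebra_simps)
  finally show ?thesis .
qed

lemma scal_re_eqI: "z + conjg z = of_real (2 * r) \<Longrightarrow> scal_re (z :: 'a :: rc_scalar) = r"
proof -
  assume "z + conjg z = of_real (2 * r)"
  then have "of_real (2 * scal_re z) = (of_real (2 * r) :: 'a)" by (simp only: of_real_scal_re)
  then show ?thesis by (simp only: of_real_eq_iff)
qed

lemma scal_re_of_real [simp]: "scal_re (of_real r :: 'a :: rc_scalar) = r"
  by (rule scal_re_eqI) (simp add: conjg_of_real)

lemma scal_re_0 [simp]: "scal_re (0 :: 'a :: rc_scalar) = 0"
  using scal_re_of_real[of 0, where 'a = 'a] by simp

lemma scal_re_conjg: "scal_re (conjg z) = scal_re (z :: 'a :: rc_scalar)"
  by (rule scal_re_eqI) (simp only: of_real_scal_re conjg_conjg add.commute)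

lemma scal_re_add: "scal_re (y + z) = scal_re y + scal_re (z :: 'a :: rc_scalar)"
proof (rule scal_re_eqI)
  have "y + z + conjg (y + z) = (y + conjg y) + (z + conjg z)"
    by (simp add: conjg_add)
  also have "\<dots> = of_real (2 * scal_re y) + of_real (2 * scal_re z)"
    by (simp only: of_real_scal_re)
  finally show "y + z + conjg (y + z) = of_real (2 * (scal_re y + scal_re z))"
    by (simp add: distrib_left)
qed

lemma scal_re_mult_of_real: "scal_re (of_real r * z) = r * scal_re (z :: 'a :: rc_scalar)"
proof (rule scal_re_eqI)
  have "of_real r * z + conjg (of_real r * z) = of_real r * (z + conjg z)"
    by (simp add: conjg_mult conjg_of_real distrib_left)
  also have "\<dots> = of_real r * of_real (2 * scal_re z)"
    by (simp only: of_real_scal_re)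
  finally show "of_real r * z + conjg (of_real r * z) = of_real (2 * (r * scal_re z))"
    by (simp add: mult.left_commute)
qed

lemma scal_re_minus: "scal_re (- z) = - scal_re (z :: 'a :: rc_scalar)"
  using scal_re_mult_of_real[of "-1" z] by simp

lemma scal_re_diff: "scal_re (y - z) = scal_re y - scal_re (z :: 'a :: rc_scalar)"
  using scal_re_add[of y "- z"] by (simp add: scal_re_minus)

lemma scal_re_le_norm: "scal_re z \<le> norm (z :: 'a :: rc_scalar)"
proof -
  have "\<bar>2 * scal_re z\<bar> = norm (z + conjg z)"
    by (metis norm_of_real of_real_scal_re)
  also have "\<dots> \<le> 2 * norm z"
    using norm_triangle_ineq[of z "conjg z"] by simp
  finally show ?thesis by simp
qed

text \<open>The case \<open>c = 0\<close> has to be covered because the forms it is applied to are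
  known only to be nonnegative.\<close>

lemma quadratic_discriminant:
  fixes a b c :: real
  assumes "\<And>t. 0 \<le> a + 2 * t * b + t\<^sup>2 * c"
  shows "b\<^sup>2 \<le> a * c"
proof (cases "c = 0")
  case True
  have "b = 0"
  proof (rule ccontr)
    assume "b \<noteq> 0"
    \<comment> \<open>At this t the expression a + 2 t b equals -1.\<close>
    then show False using assms[of "- (a + 1) / (2 * b)"] True by (simp add: field_simps)
  qed
  then show ?thesis using True by simp
next
  case False
  have a: "0 \<le> a" using assms[of 0] by simp
  \<comment> \<open>The value at the stationary point t = -b / c.\<close>
  have "0 \<le> a - b\<^sup>2 / c"
    using assms[of "- b / c"] False by (simp add: field_simps power2_eq_square)
  moreover have "c > 0"
  proof (rule ccontr)
    assume "\<not> c > 0"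
    then have c: "c < 0" using False by simp
    \<comment> \<open>Chosen so that \<open>t\<^sup>2 * c = - (a + 1)\<close>; the values at t and
      -t then add up to -2.\<close>
    define t where "t = sqrt ((a + 1) / (- c))"
    have "t\<^sup>2 = (a + 1) / (- c)" unfolding t_def using a c by (intro real_sqrt_pow2) (simp add: divide_nonneg_neg)
    then have "t\<^sup>2 * c = - (a + 1)" using c by simp
    then show False using assms[of t] assms[of "- t"] by simp
  qed
  ultimately show ?thesis by (simp add: field_simps)
qed

section \<open>Inner product geometry in finite dimension\<close>

context ip_space
begin

text \<open>Any basis will do: the locale of finite-dimensional spaces takes one as a parameter, and
  its dimension theory is what is wanted.\<close>

definition basis0 :: "'v set" where
  "basis0 = (SOME B. finite B \<and> independent B \<and> span B = UNIV)"

lemma basis0: "finite basis0 \<and> independent basis0 \<and> span basis0 = UNIV"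
proof -
  obtain S where S: "finite S" "span S = UNIV" using finite_dim by blast
  obtain B where B: "B \<subseteq> S" "independent B" "S \<subseteq> span B"
    using maximal_independent_subset[of S] by blast
  have "span B = UNIV" using span_mono[OF B(3)] S by (simp add: span_span top.extremum_unique)
  then have "finite B \<and> independent B \<and> span B = UNIV" using B S finite_subset by blast
  then show ?thesis unfolding basis0_def by (rule someI)
qed

end

sublocale ip_space \<subseteq> finite_dimensional_vector_space scale basis0
  using basis0 by unfold_locales auto

context ip_space
begin

abbreviation lin :: "('v \<Rightarrow> 'v) \<Rightarrow> bool" where "lin \<equiv> Vector_Spaces.linear scale scale"

lemma linI:
  assumes "\<And>x y. f (x + y) = f x + f y" "\<And>a x. f (scale a x) = scale a (f x)"
  shows "lin f"
  using assms vector_space_axioms by (simp add: Vector_Spaces.linear_iff)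

lemma lin_add: "lin f \<Longrightarrow> f (x + y) = f x + f y"
  and lin_scale: "lin f \<Longrightarrow> f (scale a x) = scale a (f x)"
  by (simp_all add: Vector_Spaces.linear_iff)

lemma lin_0: "lin f \<Longrightarrow> f 0 = 0"
  using lin_scale[of f 0 0] by simp

lemma lin_diff: "lin f \<Longrightarrow> f (x - y) = f x - f y"
  using lin_add[of f "x - y" y] by simp

lemma lin_sum: "lin f \<Longrightarrow> f (sum g A) = (\<Sum>a\<in>A. f (g a))"
  by (induction A rule: infinite_finite_induct) (auto simp: lin_0 lin_add)

lemma ip_0_left [simp]: "ip 0 y = 0"
  using ip_add_left[of 0 0 y] by simp

lemma ip_0_right [simp]: "ip x 0 = 0"
  by (subst ip_conjg) simp

lemma ip_add_right: "ip x (y + z) = ip x y + ip x z"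
  by (subst (1 2 3) ip_conjg) (simp add: ip_add_left conjg_add)

lemma ip_scale_right: "ip x (scale a y) = conjg a * ip x y"
  by (subst (1 2) ip_conjg) (simp add: ip_scale_left conjg_mult)

lemma ip_minus_left: "ip (- x) y = - ip x y"
  using ip_add_left[of x "- x" y] by (simp add: eq_neg_iff_add_eq_0 add.commute)

lemma ip_minus_right: "ip x (- y) = - ip x y"
  using ip_add_right[of x y "- y"] by (simp add: eq_neg_iff_add_eq_0 add.commute)

lemma ip_diff_left: "ip (x - y) z = ip x z - ip y z"
  using ip_add_left[of x "- y" z] by (simp add: ip_minus_left)

lemma ip_diff_right: "ip x (y - z) = ip x y - ip x z"
  using ip_add_right[of x y "- z"] by (simp add: ip_minus_right)

lemma ip_sum_left: "ip (sum f A) y = (\<Sum>a\<in>A. ip (f a) y)"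
  by (induction A rule: infinite_finite_induct) (auto simp: ip_add_left)

lemma ip_sum_right: "ip y (sum f A) = (\<Sum>a\<in>A. ip y (f a))"
  by (induction A rule: infinite_finite_induct) (auto simp: ip_add_right)

lemma ip_eq_0_commute: "ip x y = 0 \<longleftrightarrow> ip y x = 0"
  by (metis ip_conjg conjg_0)

definition rip :: "'v \<Rightarrow> 'v \<Rightarrow> real" where "rip x y = scal_re (ip x y)"

abbreviation sq :: "'v \<Rightarrow> real" where "sq x \<equiv> rip x x"

lemma rip_add_left: "rip (x + y) z = rip x z + rip y z"
  and rip_add_right: "rip z (x + y) = rip z x + rip z y"
  and rip_diff_left: "rip (x - y) z = rip x z - rip y z"
  and rip_diff_right: "rip z (x - y) = rip z x - rip z y"
  by (simp_all add: rip_def ip_add_left ip_add_right ip_diff_left ip_diff_right scal_re_add scal_re_diff)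

lemma rip_scale_left: "rip (scale (of_real r) x) y = r * rip x y"
  and rip_scale_right: "rip x (scale (of_real r) y) = r * rip x y"
  by (simp_all add: rip_def ip_scale_left ip_scale_right conjg_of_real scal_re_mult_of_real)

lemma rip_commute: "rip x y = rip y x"
  by (metis rip_def ip_conjg scal_re_conjg)

lemma ip_self: "ip x x = of_real (sq x)"
proof (cases "x = 0")
  case False
  then show ?thesis using ip_pos[of x] by (auto simp: rip_def)
qed (simp add: rip_def)

lemma sq_pos: "x \<noteq> 0 \<Longrightarrow> sq x > 0"
  using ip_pos[of x] by (auto simp: rip_def)

lemma sq_0 [simp]: "sq 0 = 0"
  by (simp add: rip_def)

lemma sq_nonneg [simp]: "0 \<le> sq x"
  using sq_pos[of x] by (cases "x = 0") auto

lemma sq_eq_0 [simp]: "sq x = 0 \<longleftrightarrow> x = 0"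
  using sq_pos[of x] by fastforce

lemma ip_self_eq_0: "ip x x = 0 \<longleftrightarrow> x = 0"
  by (simp add: ip_self)

lemma ip_right_eqI: "(\<And>x. ip x y = ip x z) \<Longrightarrow> y = z"
  using ip_self_eq_0[of "y - z"] by (simp add: ip_diff_right)

text \<open>Families are indexed by numbers, not given as sets of vectors, so that eigenvalues can
  carry the same index as their eigenvectors.\<close>

definition orthonormal :: "(nat \<Rightarrow> 'v) \<Rightarrow> nat set \<Rightarrow> bool" where
  "orthonormal e I \<longleftrightarrow> (\<forall>i\<in>I. \<forall>j\<in>I. ip (e i) (e j) = (if i = j then 1 else 0))"

lemma orthonormal_subset: "orthonormal e I \<Longrightarrow> J \<subseteq> I \<Longrightarrow> orthonormal e J"
  unfolding orthonormal_def by blast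

lemma ip_orthonormal_sum:
  assumes "orthonormal e I" "finite I" "j \<in> I"
  shows "ip (\<Sum>i\<in>I. scale (c i) (e i)) (e j) = c j"
proof -
  have "ip (\<Sum>i\<in>I. scale (c i) (e i)) (e j) = (\<Sum>i\<in>I. if i = j then c i else 0)"
    unfolding ip_sum_left ip_scale_left using assms by (intro sum.cong) (auto simp: orthonormal_def)
  then show ?thesis using assms by simp
qed

lemma orthonormal_nonzero: "orthonormal e I \<Longrightarrow> i \<in> I \<Longrightarrow> e i \<noteq> 0"
  by (auto simp: orthonormal_def) (metis ip_0_left zero_neq_one)

lemma orthonormal_inj_on: "orthonormal e I \<Longrightarrow> inj_on e I"
  by (rule inj_onI) (metis orthonormal_def zero_neq_one)

text \<open>The vectors equal to their own expansion form a subspace, and it contains every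
  \<open>e j\<close>.\<close>

lemma orthonormal_expand:
  assumes "orthonormal e I" "finite I" "x \<in> span (e ` I)"
  shows "x = (\<Sum>i\<in>I. scale (ip x (e i)) (e i))"
proof -
  let ?S = "{x. x = (\<Sum>i\<in>I. scale (ip x (e i)) (e i))}"
  have "subspace ?S"
  proof (rule subspaceI)
    show "0 \<in> ?S" by simp
    show "x + y \<in> ?S" if "x \<in> ?S" "y \<in> ?S" for x y
      using that by (simp add: ip_add_left scale_left_distrib sum.distrib)
    show "scale a x \<in> ?S" if "x \<in> ?S" for a x
    proof -
      have "scale a x = scale a (\<Sum>i\<in>I. scale (ip x (e i)) (e i))" using that by simp
      also have "\<dots> = (\<Sum>i\<in>I. scale (ip (scale a x) (e i)) (e i))"
        by (simp add: ip_scale_left scale_sum_right)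
      finally show ?thesis by simp
    qed
  qed
  moreover have "e ` I \<subseteq> ?S"
  proof clarify
    fix j assume j: "j \<in> I"
    have "(\<Sum>i\<in>I. scale (ip (e j) (e i)) (e i)) = (\<Sum>i\<in>I. if i = j then e i else 0)"
      using assms j by (intro sum.cong) (auto simp: orthonormal_def)
    then show "e j = (\<Sum>i\<in>I. scale (ip (e j) (e i)) (e i))" using assms j by simp
  qed
  ultimately have "span (e ` I) \<subseteq> ?S" by (intro span_minimal)
  then show ?thesis using assms by blast
qed

lemma orthonormal_independent:
  assumes "orthonormal e I" "finite I"
  shows "independent (e ` I)"
proof
  assume "dependent (e ` I)"
  then obtain i where i: "i \<in> I" "e i \<in> span (e ` I - {e i})" unfolding dependent_def by auto
  have "e ` I - {e i} \<subseteq> e ` (I - {i})" by auto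
  then have mem: "e i \<in> span (e ` (I - {i}))" using i span_mono by blast
  have "e i = (\<Sum>j\<in>I - {i}. scale (ip (e i) (e j)) (e j))"
    using assms mem by (intro orthonormal_expand) (auto intro: orthonormal_subset)
  also have "\<dots> = 0"
    using assms i by (intro sum.neutral) (auto simp: orthonormal_def)
  finally show False using orthonormal_nonzero assms i by blast
qed

lemma orthonormal_dim_span:
  assumes "orthonormal e I" "finite I"
  shows "dim (span (e ` I)) = card I"
  using orthonormal_independent[OF assms] orthonormal_inj_on[OF assms(1)]
  by (simp add: dim_eq_card_independent card_image)

lemma sum_in_span: "(\<Sum>i\<in>I. scale (c i) (e i)) \<in> span (e ` I)"
  by (intro span_sum span_scale span_base) auto

lemma parseval:
  assumes "orthonormal e I" "finite I" "x \<in> span (e ` I)"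
  shows "sq x = (\<Sum>i\<in>I. (norm (ip x (e i)))\<^sup>2)"
proof -
  have "ip x x = ip (\<Sum>i\<in>I. scale (ip x (e i)) (e i)) x"
    using orthonormal_expand[OF assms] by simp
  also have "\<dots> = (\<Sum>i\<in>I. ip x (e i) * conjg (ip x (e i)))"
    unfolding ip_sum_left ip_scale_left by (simp only: ip_conjg[where x = x])
  also have "\<dots> = of_real (\<Sum>i\<in>I. (norm (ip x (e i)))\<^sup>2)"
    by (simp only: mult_conjg of_real_sum)
  finally show ?thesis by (simp only: ip_self of_real_eq_iff)
qed

lemma subspace_orth: "subspace {x. ip x v = 0}"
  by (rule subspaceI) (auto simp: ip_add_left ip_scale_left)

lemma dim_orth_Suc:
  assumes "subspace W" "v \<in> W" "sq v = 1"
  shows "dim W = Suc (dim (W \<inter> {x. ip x v = 0}))"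
proof -
  let ?U = "W \<inter> {x. ip x v = 0}"
  have U: "subspace ?U" using assms subspace_orth by (intro subspace_inter)
  have iv: "ip v v = 1" using assms by (simp add: ip_self)
  have "v \<notin> span ?U" using U iv by (simp add: span_eq_iff[THEN iffD2])
  then have "dim (insert v ?U) = Suc (dim ?U)" by (simp add: dim_insert)
  moreover have "span (insert v ?U) = W"
  proof
    show "span (insert v ?U) \<subseteq> W" using assms by (intro span_minimal) auto
    show "W \<subseteq> span (insert v ?U)"
    proof
      fix x assume x: "x \<in> W"
      have "x - scale (ip x v) v \<in> ?U"
        using x assms iv by (auto simp: ip_diff_left ip_scale_left intro!: subspace_diff subspace_scale)
      then have "(x - scale (ip x v) v) + scale (ip x v) v \<in> span (insert v ?U)"
        by (intro span_add span_scale) (auto intro: span_base)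
      then show "x \<in> span (insert v ?U)" by simp
    qed
  qed
  ultimately show ?thesis by (metis dim_span)
qed

lemma ex_unit:
  assumes "subspace W" "W \<noteq> {0}"
  shows "\<exists>v\<in>W. sq v = 1"
proof -
  obtain w where w: "w \<in> W" "w \<noteq> 0" using assms subspace_0 by blast
  let ?v = "scale (of_real (1 / sqrt (sq w))) w"
  have "sq ?v = 1" using w sq_pos[of w]
    by (simp add: rip_scale_left rip_scale_right power2_eq_square[symmetric] field_simps del: of_real_divide)
  then show ?thesis using w assms subspace_scale by blast
qed

text \<open>The common induction behind Gram--Schmidt and the spectral theorem: split off a unit vector
  and continue in its orthogonal complement.\<close>

lemma orthonormal_flag:
  assumes "subspace W" "Q W"
    and step: "\<And>U. subspace U \<Longrightarrow> Q U \<Longrightarrow> U \<noteq> {0} \<Longrightarrow>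
      \<exists>v l. v \<in> U \<and> sq v = 1 \<and> R U v (l :: real) \<and> Q (U \<inter> {x. ip x v = 0})"
  shows "\<exists>e l. orthonormal e {..<dim W} \<and>
    (\<forall>i<dim W. \<exists>U\<subseteq>W. R U (e i) (l i) \<and> (\<forall>j. i \<le> j \<and> j < dim W \<longrightarrow> e j \<in> U))"
  using assms(1,2)
proof (induction "dim W" arbitrary: W)
  case 0
  show ?case unfolding 0(1)[symmetric] by (simp add: orthonormal_def)
next
  case (Suc d)
  have W0: "W \<noteq> {0}" using Suc(2) by auto
  obtain v l where v: "v \<in> W" "sq v = 1" "R W v l" "Q (W \<inter> {x. ip x v = 0})"
    using step[OF Suc(3,4) W0] by blast
  let ?U = "W \<inter> {x. ip x v = 0}"
  have U: "subspace ?U" using Suc(3) subspace_orth by (intro subspace_inter)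
  have dU: "d = dim ?U" using dim_orth_Suc[OF Suc(3) v(1,2)] Suc(2) by simp
  obtain e k where e: "orthonormal e {..<d}"
    and k: "\<forall>i<d. \<exists>U\<subseteq>?U. R U (e i) (k i) \<and> (\<forall>j. i \<le> j \<and> j < d \<longrightarrow> e j \<in> U)"
    using Suc(1)[OF dU U v(4)] dU by auto
  have eU: "e i \<in> ?U" if "i < d" for i using k that by blast
  \<comment> \<open>\<open>case_nat\<close> puts \<open>v\<close> and \<open>l\<close> in front of
    the families that the induction hypothesis gives for the complement.\<close>
  let ?e = "case_nat v e" and ?k = "case_nat l k"
  have "ip v v = 1" using v(2) by (simp add: ip_self)
  then have "orthonormal ?e {..<Suc d}"
    using e eU by (auto simp: orthonormal_def ip_eq_0_commute[of v] split: nat.split)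
  \<comment> \<open>The witness is the subspace from which the vector with index i was split off. It
    contains all later vectors, which is what will order the eigenvalues.\<close>
  moreover have "\<exists>U\<subseteq>W. R U (?e i) (?k i) \<and> (\<forall>j. i \<le> j \<and> j < Suc d \<longrightarrow> ?e j \<in> U)"
    if "i < Suc d" for i
  proof (cases i)
    case 0
    then show ?thesis using v eU by (intro exI[of _ W]) (auto split: nat.split)
  next
    case (Suc i')
    then have "i' < d" using that by simp
    then obtain U where "U \<subseteq> ?U" "R U (e i') (k i')" "\<forall>j. i' \<le> j \<and> j < d \<longrightarrow> e j \<in> U"
      using k by blast
    then show ?thesis using Suc by (intro exI[of _ U]) (auto split: nat.split)
  qed
  ultimately show ?case unfolding Suc(2)[symmetric]
    by (intro exI[of _ ?e] exI[of _ ?k] conjI allI impI)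
qed

lemma orthonormal_basis:
  assumes "subspace W"
  obtains e where "orthonormal e {..<dim W}" "span (e ` {..<dim W}) = W"
proof -
  have "\<exists>e (l :: nat \<Rightarrow> real). orthonormal e {..<dim W} \<and>
    (\<forall>i<dim W. \<exists>U\<subseteq>W. True \<and> (\<forall>j. i \<le> j \<and> j < dim W \<longrightarrow> e j \<in> U))"
    \<comment> \<open>Trivial \<open>Q\<close> and \<open>R\<close> leave plain Gram--Schmidt; of
      the flag only the membership in \<open>W\<close> is kept.\<close>
    by (rule orthonormal_flag[where Q = "\<lambda>_. True" and R = "\<lambda>_ _ _. True"])
      (use assms ex_unit in auto)
  then obtain e where e: "orthonormal e {..<dim W}"
    and "\<forall>i<dim W. \<exists>U\<subseteq>W. \<forall>j. i \<le> j \<and> j < dim W \<longrightarrow> e j \<in> U" by blast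
  then have sub: "e ` {..<dim W} \<subseteq> W" by blast
  have "span (e ` {..<dim W}) = W"
    using assms sub orthonormal_dim_span[OF e] by (intro subspace_dim_equal span_minimal) auto
  then show ?thesis using that e by blast
qed

end

section \<open>The spectral theorem\<close>

context ip_space
begin

definition self_adj :: "('v \<Rightarrow> 'v) \<Rightarrow> bool" where
  "self_adj A \<longleftrightarrow> lin A \<and> (\<forall>x y. ip (A x) y = ip x (A y))"

lemma self_adj_lin: "self_adj A \<Longrightarrow> lin A"
  by (simp add: self_adj_def)

lemma self_adj_ip: "self_adj A \<Longrightarrow> ip (A x) y = ip x (A y)"
  by (simp add: self_adj_def)

lemma self_adj_rip: "self_adj A \<Longrightarrow> rip (A x) y = rip x (A y)"
  by (simp add: rip_def self_adj_ip)

lemma self_adj_add: "self_adj A \<Longrightarrow> self_adj B \<Longrightarrow> self_adj (\<lambda>x. A x + B x)"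
  by (auto simp: self_adj_def ip_add_left ip_add_right lin_add lin_scale scale_right_distrib
      intro!: linI)

lemma self_adj_diff: "self_adj A \<Longrightarrow> self_adj B \<Longrightarrow> self_adj (\<lambda>x. A x - B x)"
  by (auto simp: self_adj_def ip_diff_left ip_diff_right lin_add lin_scale scale_right_diff_distrib
      intro!: linI)

lemma self_adj_scale: "self_adj (\<lambda>x. scale (of_real r) x)"
  by (auto simp: self_adj_def ip_scale_left ip_scale_right conjg_of_real scale_right_distrib
      intro!: linI)

text \<open>The quadratic polynomial in t is the value of the form at x + t y, which stays in
  \<open>W\<close>; hence nonnegativity on \<open>W\<close> suffices.\<close>

lemma rip_self_adj_cauchy_schwarz:
  assumes B: "self_adj B" and W: "subspace W" "\<And>x. x \<in> W \<Longrightarrow> 0 \<le> rip (B x) x"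
    and "x \<in> W" "y \<in> W"
  shows "(rip (B x) y)\<^sup>2 \<le> rip (B x) x * rip (B y) y"
proof (rule quadratic_discriminant)
  fix t :: real
  have lin: "lin B" using B by (rule self_adj_lin)
  have "rip (B y) x = rip (B x) y" by (metis B self_adj_rip rip_commute)
  then have "rip (B (x + scale (of_real t) y)) (x + scale (of_real t) y) =
      rip (B x) x + 2 * t * rip (B x) y + t\<^sup>2 * rip (B y) y"
    by (simp add: lin_add[OF lin] lin_scale[OF lin] rip_add_left rip_add_right rip_scale_left
        rip_scale_right algebra_simps power2_eq_square)
  then show "0 \<le> rip (B x) x + 2 * t * rip (B x) y + t\<^sup>2 * rip (B y) y"
    using W assms(4,5) subspace_add subspace_scale by metis
qed

text \<open>A bound for the quadratic form of the linear map that sends \<open>e i\<close> to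
  \<open>y i\<close>. It serves twice: with \<open>y i = A (e i)\<close> it bounds the Rayleigh
  quotient, and with \<open>y i\<close> a preimage of \<open>e i\<close> it bounds an
  inverse.\<close>

lemma rip_sum_bounded:
  assumes e: "orthonormal e I" "finite I"
  shows "\<exists>M\<ge>0. \<forall>x\<in>span (e ` I). rip x (\<Sum>i\<in>I. scale (ip x (e i)) (y i)) \<le> M * sq x"
proof (intro exI[of _ "\<Sum>i\<in>I. \<Sum>j\<in>I. norm (ip (e j) (y i))"] conjI ballI)
  fix x assume x: "x \<in> span (e ` I)"
  have c: "norm (ip x (e i)) \<le> sqrt (sq x)" if "i \<in> I" for i
  proof (rule real_le_rsqrt)
    have "(norm (ip x (e i)))\<^sup>2 \<le> (\<Sum>i\<in>I. (norm (ip x (e i)))\<^sup>2)"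
      using e that by (intro member_le_sum) auto
    then show "(norm (ip x (e i)))\<^sup>2 \<le> sq x" using parseval[OF e x] by simp
  qed
  have "ip x (\<Sum>i\<in>I. scale (ip x (e i)) (y i)) = (\<Sum>i\<in>I. conjg (ip x (e i)) * ip x (y i))"
    by (simp add: ip_sum_right ip_scale_right)
  also have "\<dots> = (\<Sum>i\<in>I. \<Sum>j\<in>I. conjg (ip x (e i)) * ip x (e j) * ip (e j) (y i))"
  proof (intro sum.cong refl)
    fix i
    have "ip x (y i) = ip (\<Sum>j\<in>I. scale (ip x (e j)) (e j)) (y i)"
      using orthonormal_expand[OF e x] by simp
    then show "conjg (ip x (e i)) * ip x (y i)
        = (\<Sum>j\<in>I. conjg (ip x (e i)) * ip x (e j) * ip (e j) (y i))"
      by (simp add: ip_sum_left ip_scale_left sum_distrib_left mult.assoc)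
  qed
  finally have "rip x (\<Sum>i\<in>I. scale (ip x (e i)) (y i))
      \<le> norm (\<Sum>i\<in>I. \<Sum>j\<in>I. conjg (ip x (e i)) * ip x (e j) * ip (e j) (y i))"
    by (simp only: rip_def scal_re_le_norm)
  also have "\<dots> \<le> (\<Sum>i\<in>I. \<Sum>j\<in>I. sqrt (sq x) * sqrt (sq x) * norm (ip (e j) (y i)))"
    using mult_mono[OF c c] by (intro sum_norm_le) (simp add: norm_mult mult_right_mono del: real_sqrt_mult_self)
  also have "\<dots> = (\<Sum>i\<in>I. \<Sum>j\<in>I. norm (ip (e j) (y i))) * sq x"
    by (simp add: sum_distrib_left sum_distrib_right mult.commute)
  finally show "rip x (\<Sum>i\<in>I. scale (ip x (e i)) (y i))
      \<le> (\<Sum>i\<in>I. \<Sum>j\<in>I. norm (ip (e j) (y i))) * sq x" .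
qed (intro sum_nonneg norm_ge_zero)

lemma dim_image_lin:
  assumes f: "lin f" and S: "subspace S" and ker: "\<And>x. x \<in> S \<Longrightarrow> f x = 0 \<Longrightarrow> x = 0"
  shows "dim (f ` S) = dim S"
proof -
  interpret p: finite_dimensional_vector_space_pair_1 scale basis0 scale by unfold_locales
  have "inj_on f S"
  proof (rule inj_onI)
    fix x y assume xy: "x \<in> S" "y \<in> S" "f x = f y"
    have "x - y \<in> S" "f (x - y) = 0"
      using xy lin_diff[OF f, of x y] subspace_diff[OF S] by simp_all
    then have "x - y = 0" by (rule ker)
    then show "x = y" by simp
  qed
  then show ?thesis using S f by (intro p.dim_image_eq) (simp_all add: span_eq_iff[THEN iffD2])
qed

lemma lin_inj_on_surj_on:
  assumes "lin B" "subspace W" "B ` W \<subseteq> W" "\<And>x. x \<in> W \<Longrightarrow> B x = 0 \<Longrightarrow> x = 0"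
  shows "B ` W = W"
proof -
  interpret p: finite_dimensional_vector_space_pair_1 scale basis0 scale by unfold_locales
  have "subspace (B ` W)"
    using assms(1,2) by (intro p.linear_subspace_image)
  then show ?thesis
    using assms(2,3) dim_image_lin[OF assms(1,2,4)] by (intro subspace_dim_equal) auto
qed

text \<open>Otherwise \<open>B = \<lambda> - A\<close>, with \<open>\<lambda>\<close> the supremum of the Rayleigh quotient, is positive and injective
  on \<open>W\<close>; by the Cauchy--Schwarz inequality for \<open>B\<close> it is then bounded below.\<close>

lemma ex_max_eigenvector:
  assumes A: "self_adj A" and W: "subspace W" "W \<noteq> {0}" "\<And>x. x \<in> W \<Longrightarrow> A x \<in> W"
  shows "\<exists>v\<in>W. \<exists>l. sq v = 1 \<and> A v = scale (of_real l) v \<and> (\<forall>x\<in>W. rip (A x) x \<le> l * sq x)"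
proof -
  obtain e where e: "orthonormal e {..<dim W}" "span (e ` {..<dim W}) = W"
    using orthonormal_basis[OF W(1)] .
  let ?R = "{rip (A x) x | x. x \<in> W \<and> sq x = 1}"
  define l where "l = Sup ?R"
  have linA: "lin A" using A by (rule self_adj_lin)
  obtain M where M: "\<And>x. x \<in> W \<Longrightarrow> rip x (\<Sum>i<dim W. scale (ip x (e i)) (A (e i))) \<le> M * sq x"
    using rip_sum_bounded[OF e(1) finite_lessThan, of "\<lambda>i. A (e i)"] e(2) by auto
  have "rip (A x) x \<le> M * sq x" if x: "x \<in> W" for x
  proof -
    have "A x = A (\<Sum>i<dim W. scale (ip x (e i)) (e i))"
      using orthonormal_expand[OF e(1)] e(2) x by simp
    also have "\<dots> = (\<Sum>i<dim W. scale (ip x (e i)) (A (e i)))"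
      by (simp add: lin_sum[OF linA] lin_scale[OF linA])
    finally show ?thesis using M[OF x] by (simp add: rip_commute)
  qed
  then have bdd: "bdd_above ?R" by (intro bdd_aboveI[of _ M]) force
  have le: "rip (A x) x \<le> l * sq x" if x: "x \<in> W" for x
  proof (cases "x = 0")
    case True
    then show ?thesis by (simp add: rip_def)
  next
    case False
    let ?c = "1 / sqrt (sq x)"
    let ?u = "scale (of_real ?c) x"
    have c: "?c * ?c * sq x = 1" using sq_pos[OF False] False by simp
    then have "sq ?u = 1" by (simp add: rip_scale_left rip_scale_right del: of_real_divide)
    moreover have "?u \<in> W" using x W(1) subspace_scale by blast
    ultimately have "rip (A ?u) ?u \<le> l" unfolding l_def by (intro cSup_upper bdd) blast
    then have "?c * ?c * rip (A x) x \<le> l"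
      by (simp add: lin_scale[OF linA] rip_scale_left rip_scale_right del: of_real_divide)
    then show ?thesis using sq_pos[OF False] by (simp add: field_simps)
  qed
  define B where "B x = scale (of_real l) x - A x" for x
  have B: "self_adj B" unfolding B_def by (intro self_adj_diff self_adj_scale A)
  have BW: "B x \<in> W" if "x \<in> W" for x
    unfolding B_def using that W by (intro subspace_diff subspace_scale) auto
  have rB: "rip (B x) x = l * sq x - rip (A x) x" for x
    by (simp add: B_def rip_diff_left rip_scale_left)
  have "\<exists>x\<in>W. x \<noteq> 0 \<and> B x = 0"
  proof (rule ccontr)
    assume "\<not> ?thesis"
    then have "B ` W = W"
      using B BW W(1) by (intro lin_inj_on_surj_on) (auto simp: self_adj_lin)
    then have "\<exists>y\<in>W. B y = x" if "x \<in> W" for x using that by (metis imageE)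
    moreover have eW: "e i \<in> W" if "i < dim W" for i
      using e(2) that span_base[of "e i" "e ` {..<dim W}"] by simp
    ultimately have "\<forall>i. \<exists>y. i < dim W \<longrightarrow> y \<in> W \<and> B y = e i" by blast
    from choice[OF this] obtain y where y: "\<And>i. i < dim W \<Longrightarrow> y i \<in> W \<and> B (y i) = e i" by blast
    obtain M where M: "M \<ge> 0" "\<And>x. x \<in> W \<Longrightarrow> rip x (\<Sum>i<dim W. scale (ip x (e i)) (y i)) \<le> M * sq x"
      using rip_sum_bounded[OF e(1) finite_lessThan, of y] unfolding e(2) by blast
    have "rip (A u) u \<le> l - 1 / (M + 1)" if u: "u \<in> W" "sq u = 1" for u
    proof -
      \<comment> \<open>\<open>?w\<close> is the preimage of \<open>u\<close> under
        \<open>B\<close>, so \<open>rip (B ?w) ?w = rip u ?w\<close> is the form of the inverse at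
        the unit vector \<open>u\<close> and is at most \<open>M\<close>.\<close>
      let ?w = "\<Sum>i<dim W. scale (ip u (e i)) (y i)"
      have w: "?w \<in> W" using y W(1) by (intro subspace_sum subspace_scale) auto
      have "B ?w = (\<Sum>i<dim W. scale (ip u (e i)) (e i))"
        using y by (simp add: lin_sum[OF self_adj_lin[OF B]] lin_scale[OF self_adj_lin[OF B]])
      also have "\<dots> = u" using orthonormal_expand[OF e(1)] e(2) u by simp
      finally have Bw: "B ?w = u" .
      have "1 = (rip (B ?w) u)\<^sup>2" using Bw u by simp
      also have "\<dots> \<le> rip (B ?w) ?w * rip (B u) u"
        using le rB by (intro rip_self_adj_cauchy_schwarz[OF B W(1) _ w u(1)]) simp
      also have "\<dots> \<le> M * rip (B u) u"
        using M(2)[OF u(1)] le[OF u(1)] rB u(2) Bw by (intro mult_right_mono) auto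
      \<comment> \<open>Enlarging \<open>M\<close> to \<open>M + 1\<close> makes the factor
        positive, so that dividing by it is safe.\<close>
      also have "\<dots> \<le> (M + 1) * rip (B u) u"
        using le[OF u(1)] rB by (intro mult_right_mono) auto
      finally have "1 / (M + 1) \<le> rip (B u) u" using M(1) by (simp add: field_simps)
      then show ?thesis using rB u(2) by simp
    qed
    moreover have "?R \<noteq> {}" using ex_unit[OF W(1,2)] by blast
    \<comment> \<open>\<open>l\<close> is the least upper bound, yet all Rayleigh quotients stay
      below it by a fixed margin.\<close>
    ultimately have "l \<le> l - 1 / (M + 1)" unfolding l_def by (intro cSup_least) auto
    then show False using M(1) by simp
  qed
  then obtain x where x: "x \<in> W" "x \<noteq> 0" "B x = 0" by blast
  let ?u = "scale (of_real (1 / sqrt (sq x))) x"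
  have "sq ?u = 1" using sq_pos[OF x(2)] x(2) by (simp add: rip_scale_left rip_scale_right del: of_real_divide)
  moreover have "?u \<in> W" using x W(1) subspace_scale by blast
  moreover have "A x = scale (of_real l) x" using x(3) unfolding B_def by simp
  then have "A ?u = scale (of_real l) ?u" by (simp only: lin_scale[OF linA] scale_scale mult.commute)
  ultimately show ?thesis using le by blast
qed

text \<open>The order is part of the notion, so that index i means the i-th largest eigenvalue
  counted with multiplicity; values of \<open>l\<close> from \<open>dim UNIV\<close> on are
  arbitrary.\<close>

definition eigsys :: "('v \<Rightarrow> 'v) \<Rightarrow> (nat \<Rightarrow> 'v) \<Rightarrow> (nat \<Rightarrow> real) \<Rightarrow> bool" where
  "eigsys A e l \<longleftrightarrow> lin A \<and> orthonormal e {..<dim UNIV} \<and>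
     (\<forall>i<dim UNIV. A (e i) = scale (of_real (l i)) (e i)) \<and> antimono_on {..<dim UNIV} l"

lemma orthonormal_sq:
  assumes "orthonormal e I" "i \<in> I"
  shows "sq (e i) = 1"
proof -
  have "ip (e i) (e i) = of_real 1" using assms by (simp add: orthonormal_def)
  then show ?thesis by (simp only: rip_def scal_re_of_real)
qed

theorem spectral:
  assumes A: "self_adj A"
  obtains e l where "eigsys A e l"
proof -
  \<comment> \<open>Besides the eigenvector equation, \<open>?R\<close> records that
    \<open>l\<close> is the maximum of the form on \<open>U\<close>. Later eigenvectors lie in
    \<open>U\<close>, so their eigenvalues cannot be larger.\<close>
  let ?R = "\<lambda>U v l. A v = scale (of_real l) v \<and> (\<forall>x\<in>U. rip (A x) x \<le> l * sq x)"
  have "\<exists>e l. orthonormal e {..<dim UNIV} \<and>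
    (\<forall>i<dim UNIV. \<exists>U\<subseteq>UNIV. ?R U (e i) (l i) \<and> (\<forall>j. i \<le> j \<and> j < dim UNIV \<longrightarrow> e j \<in> U))"
  proof (rule orthonormal_flag[where Q = "\<lambda>U. \<forall>x\<in>U. A x \<in> U" and R = ?R])
    fix U assume U: "subspace U" "\<forall>x\<in>U. A x \<in> U" "U \<noteq> {0}"
    then obtain v l where v: "v \<in> U" "sq v = 1" "?R U v l"
      using ex_max_eigenvector[OF A U(1,3) U(2)[rule_format]] by blast
    moreover have "\<forall>x\<in>U \<inter> {x. ip x v = 0}. A x \<in> U \<inter> {x. ip x v = 0}"
      using v(3) U(2) by (auto simp: self_adj_ip[OF A] ip_scale_right)
    ultimately show "\<exists>v l. v \<in> U \<and> sq v = 1 \<and> ?R U v l \<and>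
        (\<forall>x\<in>U \<inter> {x. ip x v = 0}. A x \<in> U \<inter> {x. ip x v = 0})" by blast
  qed auto
  then obtain e l where e: "orthonormal e {..<dim UNIV}"
    and l: "\<forall>i<dim UNIV. \<exists>U\<subseteq>UNIV. ?R U (e i) (l i) \<and> (\<forall>j. i \<le> j \<and> j < dim UNIV \<longrightarrow> e j \<in> U)"
    by (elim exE conjE) (rule that)
  have ev: "A (e i) = scale (of_real (l i)) (e i)" if "i < dim UNIV" for i
    using l[rule_format, OF that] by (elim exE conjE)
  have "l j \<le> l i" if ij: "i \<le> j" "j < dim UNIV" for i j
  proof -
    have "rip (A (e j)) (e j) \<le> l i * sq (e j)"
      using l[rule_format, OF le_less_trans[OF ij]] ij by blast
    moreover have "sq (e j) = 1"
      using e ij(2) by (intro orthonormal_sq) auto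
    ultimately show ?thesis using ev[OF ij(2)] by (simp add: rip_scale_left)
  qed
  then have "antimono_on {..<dim UNIV} l" by (intro monotone_onI) auto
  then have "eigsys A e l" using e ev self_adj_lin[OF A] unfolding eigsys_def by blast
  then show ?thesis by (rule that)
qed

end

section \<open>The inequality of Lidskii\<close>

text \<open>The negative part reads the eigenvalues from the end, so that both parts of a nonincreasing
  list are nonincreasing sequences; they are padded by zeros.\<close>

definition pos_part :: "nat \<Rightarrow> (nat \<Rightarrow> real) \<Rightarrow> nat \<Rightarrow> real" where
  "pos_part n l i = (if i < n then max (l i) 0 else 0)"

definition neg_part :: "nat \<Rightarrow> (nat \<Rightarrow> real) \<Rightarrow> nat \<Rightarrow> real" where
  "neg_part n l i = (if i < n then max (- l (n - Suc i)) 0 else 0)"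

lemma sum_le_sum_lessThan:
  fixes f :: "nat \<Rightarrow> real"
  assumes "finite J" "\<And>i. i < n \<Longrightarrow> 0 \<le> f i" "\<And>i. n \<le> i \<Longrightarrow> f i = 0"
  shows "sum f J \<le> sum f {..<n}"
proof -
  have "sum f J = sum f (J \<inter> {..<n})"
  proof (rule sum.mono_neutral_right[OF assms(1)])
    show "\<forall>i\<in>J - J \<inter> {..<n}. f i = 0" by (auto intro!: assms(3))
  qed simp
  also have "\<dots> \<le> sum f {..<n}" using assms by (intro sum_mono2) auto
  finally show ?thesis .
qed

text \<open>Raising \<open>l\<close> to \<open>u + t\<close> costs at most \<open>t\<close> per
  index. What is left, positive parts of \<open>u\<close> minus those of \<open>m\<close> and
  negative parts of \<open>m\<close> minus those of \<open>u\<close>, is termwise nonnegative, so it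
  may be summed over all indices; then x = max x 0 - max (-x) 0 yields the sum of
  \<open>u i - m i\<close>.\<close>

lemma sum_pos_neg_part_le:
  assumes "finite J" "finite K" "0 \<le> t"
    and "\<And>i. i < n \<Longrightarrow> l i \<le> u i + t" "\<And>i. i < n \<Longrightarrow> m i \<le> u i"
  shows "(\<Sum>i\<in>J. pos_part n l i - pos_part n m i) + (\<Sum>i\<in>K. neg_part n m i - neg_part n l i)
    \<le> real (card J + card K) * t + (\<Sum>i<n. u i - m i)"
proof -
  have "(\<Sum>i\<in>J. pos_part n l i - pos_part n m i) \<le> (\<Sum>i\<in>J. t + (pos_part n u i - pos_part n m i))"
    using assms(3,4) by (intro sum_mono) (force simp: pos_part_def)
  also have "\<dots> = card J * t + (\<Sum>i\<in>J. pos_part n u i - pos_part n m i)"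
    by (simp add: sum.distrib)
  also have "(\<Sum>i\<in>J. pos_part n u i - pos_part n m i) \<le> (\<Sum>i<n. pos_part n u i - pos_part n m i)"
    using assms(5) by (intro sum_le_sum_lessThan assms(1)) (force simp: pos_part_def)+
  finally have J: "(\<Sum>i\<in>J. pos_part n l i - pos_part n m i)
    \<le> card J * t + (\<Sum>i<n. max (u i) 0 - max (m i) 0)" by (simp add: pos_part_def)
  have "neg_part n u i \<le> neg_part n l i + t" for i
    using assms(3) assms(4)[of "n - Suc i"] by (auto simp: neg_part_def)
  then have "(\<Sum>i\<in>K. neg_part n m i - neg_part n l i) \<le> (\<Sum>i\<in>K. t + (neg_part n m i - neg_part n u i))"
    by (intro sum_mono) (simp add: algebra_simps)
  also have "\<dots> = card K * t + (\<Sum>i\<in>K. neg_part n m i - neg_part n u i)"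
    by (simp add: sum.distrib)
  also have "(\<Sum>i\<in>K. neg_part n m i - neg_part n u i) \<le> (\<Sum>i<n. neg_part n m i - neg_part n u i)"
  proof (rule sum_le_sum_lessThan[OF assms(2)])
    show "0 \<le> neg_part n m i - neg_part n u i" if "i < n" for i
      using assms(5)[of "n - Suc i"] that by (auto simp: neg_part_def)
  qed (simp add: neg_part_def)
  also have "\<dots> = (\<Sum>i<n. max (- m (n - Suc i)) 0 - max (- u (n - Suc i)) 0)"
    by (simp add: neg_part_def)
  also have "\<dots> = (\<Sum>i<n. max (- m i) 0 - max (- u i) 0)"
    by (rule sum.nat_diff_reindex)
  finally have "(\<Sum>i\<in>J. pos_part n l i - pos_part n m i) + (\<Sum>i\<in>K. neg_part n m i - neg_part n l i)
    \<le> real (card J + card K) * t +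
      ((\<Sum>i<n. max (u i) 0 - max (m i) 0) + (\<Sum>i<n. max (- m i) 0 - max (- u i) 0))"
    using J by (simp add: distrib_right)
  also have "(\<Sum>i<n. max (u i) 0 - max (m i) 0) + (\<Sum>i<n. max (- m i) 0 - max (- u i) 0)
      = (\<Sum>i<n. u i - m i)"
    unfolding sum.distrib[symmetric] by (intro sum.cong) (auto simp: max_def)
  finally show ?thesis .
qed

context ip_space
begin

lemma orthonormal_span_UNIV:
  assumes "orthonormal e {..<dim UNIV}"
  shows "span (e ` {..<dim UNIV}) = UNIV"
  using orthonormal_dim_span[OF assms] by (intro subspace_dim_equal) auto

lemma orthonormal_coeff_0:
  assumes "orthonormal e I" "J \<subseteq> I" "x \<in> span (e ` J)" "i \<in> I - J"
  shows "ip x (e i) = 0"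
proof -
  have "span (e ` J) \<subseteq> {x. ip x (e i) = 0}"
    using assms by (intro span_minimal subspace_orth) (auto simp: orthonormal_def)
  then show ?thesis using assms by blast
qed

section \<open>Expansion in an orthonormal basis of eigenvectors\<close>

context
  fixes A e l
  assumes es: "eigsys A e l"
begin

lemma eigsys_lin: "lin A"
  and eigsys_orthonormal: "orthonormal e {..<dim UNIV}"
  and eigsys_eigenvector: "i < dim UNIV \<Longrightarrow> A (e i) = scale (of_real (l i)) (e i)"
  using es by (simp_all only: eigsys_def)

lemma eigsys_antimono: "i \<le> j \<Longrightarrow> j < dim UNIV \<Longrightarrow> l j \<le> l i"
  using es by (auto simp only: eigsys_def monotone_on_def lessThan_iff)

lemma eigsys_expand: "x = (\<Sum>i<dim UNIV. scale (ip x (e i)) (e i))"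
  by (rule orthonormal_expand[OF eigsys_orthonormal finite_lessThan])
    (simp only: orthonormal_span_UNIV[OF eigsys_orthonormal] UNIV_I)

lemma eigsys_parseval: "sq x = (\<Sum>i<dim UNIV. (norm (ip x (e i)))\<^sup>2)"
  by (rule parseval[OF eigsys_orthonormal finite_lessThan])
    (simp only: orthonormal_span_UNIV[OF eigsys_orthonormal] UNIV_I)

lemma eigsys_apply: "A x = (\<Sum>i<dim UNIV. scale (of_real (l i) * ip x (e i)) (e i))"
proof -
  have "A x = A (\<Sum>i<dim UNIV. scale (ip x (e i)) (e i))"
    using eigsys_expand by simp
  also have "\<dots> = (\<Sum>i<dim UNIV. scale (ip x (e i)) (A (e i)))"
    by (simp only: lin_sum[OF eigsys_lin] lin_scale[OF eigsys_lin])
  also have "\<dots> = (\<Sum>i<dim UNIV. scale (of_real (l i) * ip x (e i)) (e i))"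
    by (intro sum.cong refl) (simp only: eigsys_eigenvector lessThan_iff scale_scale mult.commute)
  finally show ?thesis .
qed

lemma eigsys_coeff: "j < dim UNIV \<Longrightarrow> ip (A x) (e j) = of_real (l j) * ip x (e j)"
  unfolding eigsys_apply[of x]
  by (rule ip_orthonormal_sum[OF eigsys_orthonormal finite_lessThan]) simp

lemma eigsys_quad: "rip (A x) x = (\<Sum>i<dim UNIV. l i * (norm (ip x (e i)))\<^sup>2)"
proof -
  have "ip (A x) x = (\<Sum>i<dim UNIV. of_real (l i) * (ip x (e i) * conjg (ip x (e i))))"
    unfolding eigsys_apply[of x] ip_sum_left ip_scale_left
    by (simp only: ip_conjg[where x = x] mult.assoc)
  also have "\<dots> = of_real (\<Sum>i<dim UNIV. l i * (norm (ip x (e i)))\<^sup>2)"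
    by (simp only: mult_conjg of_real_sum of_real_mult)
  finally show ?thesis by (simp only: rip_def scal_re_of_real)
qed

text \<open>Applying \<open>A\<close> multiplies the coefficient at \<open>e i\<close> by
  \<open>l i\<close>, so an eigenvector for s has zero coefficient wherever \<open>l i\<close>
  differs from s.\<close>

lemma eigenspace_eq_span:
  "{v. A v = scale (of_real s) v} = span (e ` {i. i < dim UNIV \<and> l i = s})" (is "?E = span (e ` ?I)")
proof
  have "subspace ?E"
    by (rule subspaceI)
      (simp_all add: lin_0[OF eigsys_lin] lin_add[OF eigsys_lin] lin_scale[OF eigsys_lin]
        scale_right_distrib mult.commute)
  then show "span (e ` ?I) \<subseteq> ?E"
    using eigsys_eigenvector by (intro span_minimal) auto
  show "?E \<subseteq> span (e ` ?I)"
  proof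
    fix v assume v: "v \<in> ?E"
    have c: "ip v (e i) = 0" if "i < dim UNIV" "l i \<noteq> s" for i
    proof -
      have "of_real (l i) * ip v (e i) = of_real s * ip v (e i)"
        using v eigsys_coeff[OF that(1), of v] by (simp only: mem_Collect_eq ip_scale_left)
      then show ?thesis using that(2) by auto
    qed
    have "v = (\<Sum>i<dim UNIV. scale (ip v (e i)) (e i))" by (rule eigsys_expand)
    also have "\<dots> = (\<Sum>i\<in>?I. scale (ip v (e i)) (e i))"
      using c by (intro sum.mono_neutral_right) auto
    also have "\<dots> \<in> span (e ` ?I)" by (rule sum_in_span)
    finally show "v \<in> span (e ` ?I)" .
  qed
qed

lemma dim_eigenspace: "dim {v. A v = scale (of_real s) v} = card {i. i < dim UNIV \<and> l i = s}"
  unfolding eigenspace_eq_span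
  by (rule orthonormal_dim_span[OF orthonormal_subset[OF eigsys_orthonormal]]) auto

text \<open>With the next lemma, the two estimates behind the Courant--Fischer principle: only
  eigenvalues at least \<open>l i\<close> contribute on the head, only those at most
  \<open>l i\<close> on the tail.\<close>

lemma quad_ge_on_head:
  assumes "i < dim UNIV" "x \<in> span (e ` {..i})"
  shows "l i * sq x \<le> rip (A x) x"
proof -
  have "l i * (norm (ip x (e j)))\<^sup>2 \<le> l j * (norm (ip x (e j)))\<^sup>2" if "j < dim UNIV" for j
  proof (cases "j \<le> i")
    case True
    then show ?thesis using eigsys_antimono assms(1) by (intro mult_right_mono) auto
  next
    case False
    then have "ip x (e j) = 0"
      using assms that by (intro orthonormal_coeff_0[OF eigsys_orthonormal _ assms(2)]) auto
    then show ?thesis by simp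
  qed
  then show ?thesis
    unfolding eigsys_quad eigsys_parseval[of x] sum_distrib_left by (intro sum_mono) simp
qed

lemma quad_le_on_tail:
  assumes "x \<in> span (e ` {i..<dim UNIV})"
  shows "rip (A x) x \<le> l i * sq x"
proof -
  have "l j * (norm (ip x (e j)))\<^sup>2 \<le> l i * (norm (ip x (e j)))\<^sup>2" if "j < dim UNIV" for j
  proof (cases "i \<le> j")
    case True
    then show ?thesis using eigsys_antimono that by (intro mult_right_mono) auto
  next
    case False
    then have "ip x (e j) = 0"
      using that by (intro orthonormal_coeff_0[OF eigsys_orthonormal _ assms]) auto
    then show ?thesis by simp
  qed
  then show ?thesis
    unfolding eigsys_quad eigsys_parseval[of x] sum_distrib_left by (intro sum_mono) simp
qed

text \<open>The trace does not depend on the orthonormal basis: expand each form in the eigenbasis,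
  exchange the sums, and apply Parseval to \<open>e j\<close> in the basis \<open>g\<close>.\<close>

lemma trace_eq_sum_eigenvalues:
  assumes g: "orthonormal g {..<dim UNIV}"
  shows "(\<Sum>i<dim UNIV. rip (A (g i)) (g i)) = (\<Sum>i<dim UNIV. l i)"
proof -
  have "(\<Sum>i<dim UNIV. rip (A (g i)) (g i))
      = (\<Sum>j<dim UNIV. \<Sum>i<dim UNIV. l j * (norm (ip (g i) (e j)))\<^sup>2)"
    unfolding eigsys_quad by (rule sum.swap)
  also have "\<dots> = (\<Sum>j<dim UNIV. l j)"
  proof (intro sum.cong refl)
    fix j assume j: "j \<in> {..<dim UNIV}"
    have "sq (e j) = 1" using eigsys_orthonormal j by (rule orthonormal_sq)
    have "(\<Sum>i<dim UNIV. (norm (ip (g i) (e j)))\<^sup>2) = (\<Sum>i<dim UNIV. (norm (ip (e j) (g i)))\<^sup>2)"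
      by (simp only: ip_conjg[of "e j"] norm_conjg)
    also have "\<dots> = sq (e j)"
      by (rule parseval[OF g finite_lessThan, symmetric]) (simp only: orthonormal_span_UNIV[OF g] UNIV_I)
    finally show "(\<Sum>i<dim UNIV. l j * (norm (ip (g i) (e j)))\<^sup>2) = l j"
      using \<open>sq (e j) = 1\<close> by (simp only: sum_distrib_left[symmetric] mult_1_right)
  qed
  finally show ?thesis .
qed

end

text \<open>Weyl's monotonicity. The first i + 1 eigenvectors of \<open>A\<close> and the
  eigenvectors of \<open>B\<close> from index i on span subspaces whose dimensions add up to more
  than that of the space; a common nonzero vector compares the eigenvalues.\<close>

lemma eigenvalue_mono:
  assumes A: "eigsys A e l" and B: "eigsys B f m"
    and le: "\<And>x. rip (A x) x \<le> rip (B x) x + t * sq x" and i: "i < dim UNIV"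
  shows "l i \<le> m i + t"
proof -
  let ?S = "span (e ` {..i})" and ?T = "span (f ` {i..<dim UNIV})"
  have "dim ?S = Suc i"
    using i by (subst orthonormal_dim_span[OF orthonormal_subset[OF eigsys_orthonormal[OF A]]]) auto
  moreover have "dim ?T = dim UNIV - i"
    by (subst orthonormal_dim_span[OF orthonormal_subset[OF eigsys_orthonormal[OF B]]]) auto
  moreover have "dim {x + y |x y. x \<in> ?S \<and> y \<in> ?T} + dim (?S \<inter> ?T) = dim ?S + dim ?T"
    by (intro dim_sums_Int) auto
  moreover have "dim {x + y |x y. x \<in> ?S \<and> y \<in> ?T} \<le> dim UNIV"
    by (intro dim_subset) auto
  ultimately have "dim (?S \<inter> ?T) \<noteq> 0" using i by linarith
  then obtain x where x: "x \<in> ?S" "x \<in> ?T" "x \<noteq> 0" by auto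
  have "l i * sq x \<le> rip (A x) x" by (rule quad_ge_on_head[OF A i x(1)])
  also have "\<dots> \<le> rip (B x) x + t * sq x" by (rule le)
  also have "rip (B x) x \<le> m i * sq x" by (rule quad_le_on_tail[OF B x(2)])
  finally have "l i * sq x \<le> (m i + t) * sq x" by (simp add: distrib_right)
  then show ?thesis using sq_pos[OF x(3)] by simp
qed

text \<open>The argument of Li and Mathias: \<open>A - B \<le> t + F\<close> where \<open>F\<close> is the positive part of \<open>A - B - t\<close>,
  so that \<open>A\<close> may be replaced by \<open>B + F\<close>, whose eigenvalues dominate those of \<open>B\<close>; the sum over an
  index set is then bounded by the trace of \<open>F\<close>.\<close>

lemma lidskii:
  assumes B: "self_adj B"
    and esA: "eigsys A e l" and esB: "eigsys B f m" and esD: "eigsys (\<lambda>x. A x - B x) g d"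
    and fin: "finite J" "finite K"
  shows "(\<Sum>i\<in>J. pos_part (dim UNIV) l i - pos_part (dim UNIV) m i)
      + (\<Sum>i\<in>K. neg_part (dim UNIV) m i - neg_part (dim UNIV) l i)
    \<le> (\<Sum>i<card J + card K. pos_part (dim UNIV) d i)"
proof -
  define n where "n = dim UNIV"
  define k where "k = card J + card K"
  \<comment> \<open>The \<open>k\<close>-th largest entry of the positive part of \<open>d\<close>,
    hence nonnegative. For \<open>k = 0\<close> truncated subtraction reads the largest entry, so
    that \<open>p\<close> vanishes below \<open>n\<close>.\<close>
  define t where "t = pos_part n d (k - 1)"
  define p where "p i = max (d i - t) 0" for i
  define F where "F x = (\<Sum>i<n. scale (of_real (p i) * ip x (g i)) (g i))" for x
  have t0: "0 \<le> t" by (simp add: t_def pos_part_def)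
  have g: "orthonormal g {..<n}" unfolding n_def by (rule eigsys_orthonormal[OF esD])
  have linF: "lin F"
    by (rule linI) (simp_all add: F_def ip_add_left ip_scale_left scale_left_distrib distrib_left
        sum.distrib scale_sum_right mult.left_commute)
  have F: "self_adj F"
    unfolding self_adj_def
  proof (intro conjI allI linF)
    fix x y
    show "ip (F x) y = ip x (F y)"
      unfolding F_def ip_sum_left ip_sum_right ip_scale_left ip_scale_right conjg_mult conjg_of_real
      by (intro sum.cong refl) (metis ip_conjg mult.assoc mult.commute)
  qed
  have Fquad: "rip (F x) x = (\<Sum>i<n. p i * (norm (ip x (g i)))\<^sup>2)" for x
  proof -
    have "ip (F x) x = (\<Sum>i<n. of_real (p i) * (ip x (g i) * conjg (ip x (g i))))"
      unfolding F_def ip_sum_left ip_scale_left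
      by (simp only: ip_conjg[where x = x] mult.assoc)
    also have "\<dots> = of_real (\<Sum>i<n. p i * (norm (ip x (g i)))\<^sup>2)"
      by (simp only: mult_conjg of_real_sum of_real_mult)
    finally show ?thesis by (simp only: rip_def scal_re_of_real)
  qed
  obtain h u where esG: "eigsys (\<lambda>x. B x + F x) h u"
    using spectral[OF self_adj_add[OF B F]] .
  have "l i \<le> u i + t" if "i < n" for i
  proof (rule eigenvalue_mono[OF esA esG _ that[unfolded n_def]])
    fix x
    have "rip (A x - B x) x = (\<Sum>i<n. d i * (norm (ip x (g i)))\<^sup>2)"
      unfolding n_def by (rule eigsys_quad[OF esD])
    also have "\<dots> \<le> (\<Sum>i<n. (p i + t) * (norm (ip x (g i)))\<^sup>2)"
      by (intro sum_mono mult_right_mono) (auto simp: p_def)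
    also have "\<dots> = rip (F x) x + t * sq x"
      unfolding Fquad eigsys_parseval[OF esD, of x] n_def
      by (simp only: distrib_right sum.distrib sum_distrib_left)
    finally show "rip (A x) x \<le> rip (B x + F x) x + t * sq x"
      by (simp add: rip_diff_left rip_add_left)
  qed
  moreover have "m i \<le> u i" if "i < n" for i
  proof -
    have "m i \<le> u i + 0"
    proof (rule eigenvalue_mono[OF esB esG _ that[unfolded n_def]])
      fix x
      have "0 \<le> rip (F x) x" unfolding Fquad by (intro sum_nonneg) (simp add: p_def)
      then show "rip (B x) x \<le> rip (B x + F x) x + 0 * sq x" by (simp add: rip_add_left)
    qed
    then show ?thesis by simp
  qed
  ultimately have "(\<Sum>i\<in>J. pos_part n l i - pos_part n m i) + (\<Sum>i\<in>K. neg_part n m i - neg_part n l i)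
    \<le> real k * t + (\<Sum>i<n. u i - m i)"
    unfolding k_def using fin t0 by (intro sum_pos_neg_part_le) auto
  \<comment> \<open>Evaluating the traces of \<open>B\<close> and of \<open>B + F\<close> in the
    eigenbasis \<open>g\<close> of \<open>A - B\<close> makes \<open>F\<close> diagonal with entries
    \<open>p i\<close>.\<close>
  also have "(\<Sum>i<n. u i - m i) = (\<Sum>i<n. p i)"
  proof -
    have gn: "orthonormal g {..<dim UNIV}" using g by (simp only: n_def)
    have "(\<Sum>i<n. u i) = (\<Sum>i<n. rip (B (g i) + F (g i)) (g i))"
      unfolding n_def by (rule trace_eq_sum_eigenvalues[OF esG gn, symmetric])
    also have "\<dots> = (\<Sum>i<n. rip (B (g i)) (g i)) + (\<Sum>i<n. rip (F (g i)) (g i))"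
      by (simp only: rip_add_left sum.distrib)
    also have "(\<Sum>i<n. rip (B (g i)) (g i)) = (\<Sum>i<n. m i)"
      unfolding n_def by (rule trace_eq_sum_eigenvalues[OF esB gn])
    also have "(\<Sum>i<n. rip (F (g i)) (g i)) = (\<Sum>i<n. p i)"
    proof (intro sum.cong refl)
      fix i assume i: "i \<in> {..<n}"
      have "rip (F (g i)) (g i) = (\<Sum>j<n. if j = i then p i else 0)"
        unfolding Fquad using g i by (intro sum.cong refl) (auto simp: orthonormal_def)
      then show "rip (F (g i)) (g i) = p i" using i by simp
    qed
    finally show ?thesis by (simp add: sum_subtractf)
  qed
  also have "(\<Sum>i<n. p i) \<le> (\<Sum>i<k. pos_part n d i - t)"
  proof -
    have anti: "d j \<le> d i" if "i \<le> j" "j < n" for i j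
      using eigsys_antimono[OF esD that(1)] that(2) by (simp only: n_def)
    have posd: "pos_part n d j \<le> pos_part n d i" if "i \<le> j" for i j
      using anti[OF that] that by (auto simp: pos_part_def)
    \<comment> \<open>As \<open>t\<close> is nonnegative, \<open>d\<close> may be replaced by its
      positive part.\<close>
    have "(\<Sum>i<n. p i) = (\<Sum>i<n. max (pos_part n d i - t) 0)"
      using t0 by (intro sum.cong) (auto simp: p_def pos_part_def max_def)
    also have "\<dots> \<le> (\<Sum>i<k. max (pos_part n d i - t) 0)"
    proof (rule sum_le_sum_lessThan)
      fix i assume "k \<le> i"
      then have "pos_part n d i \<le> t" unfolding t_def by (intro posd) simp
      then show "max (pos_part n d i - t) 0 = 0" by simp
    qed auto
    also have "\<dots> = (\<Sum>i<k. pos_part n d i - t)"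
      using posd by (intro sum.cong refl) (auto simp: t_def)
    finally show ?thesis .
  qed
  \<comment> \<open>The \<open>k\<close> subtracted copies of \<open>t\<close> cancel against
    \<open>real k * t\<close>.\<close>
  finally show ?thesis unfolding n_def k_def by (simp add: sum_subtractf)
qed

end

section \<open>Pairs of orthogonal projections\<close>

context ip_space
begin

definition orth :: "'v set \<Rightarrow> 'v set" where
  "orth X = {v. \<forall>w\<in>X. ip v w = 0}"

lemma subspace_orth_set: "subspace (orth X)"
  by (rule subspaceI) (auto simp: orth_def ip_add_left ip_scale_left)

lemma proj_unique:
  assumes "subspace X" "u \<in> X" "v - u \<in> orth X" "u' \<in> X" "v - u' \<in> orth X"
  shows "u = u'"
proof -
  have "(v - u') - (v - u) \<in> orth X" by (intro subspace_diff subspace_orth_set assms)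
  then have "u - u' \<in> orth X" by simp
  moreover have "u - u' \<in> X" by (intro subspace_diff assms)
  ultimately have "ip (u - u') (u - u') = 0" unfolding orth_def by blast
  then show ?thesis by (simp add: ip_self_eq_0)
qed

lemma proj_props:
  assumes X: "subspace X"
  shows "proj X v \<in> X \<and> v - proj X v \<in> orth X"
proof -
  obtain e where e: "orthonormal e {..<dim X}" "span (e ` {..<dim X}) = X"
    using orthonormal_basis[OF X] .
  let ?u = "\<Sum>i<dim X. scale (ip v (e i)) (e i)"
  have u: "?u \<in> X" using sum_in_span[of "\<lambda>i. ip v (e i)" e "{..<dim X}"] e(2) by simp
  have "e ` {..<dim X} \<subseteq> {w. ip w (v - ?u) = 0}"
  proof clarify
    fix i assume i: "i < dim X"
    have "ip (v - ?u) (e i) = 0"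
      using ip_orthonormal_sum[OF e(1) finite_lessThan] i by (simp add: ip_diff_left)
    then show "ip (e i) (v - ?u) = 0" using ip_eq_0_commute by blast
  qed
  from span_minimal[OF this subspace_orth] have "X \<subseteq> {w. ip w (v - ?u) = 0}"
    by (simp only: e(2))
  then have "v - ?u \<in> orth X" unfolding orth_def using ip_eq_0_commute by blast
  then have "\<exists>!u. u \<in> X \<and> v - u \<in> orth X" using u proj_unique[OF X] by blast
  moreover have "proj X v = (THE u. u \<in> X \<and> v - u \<in> orth X)"
    by (simp add: proj_def orth_def)
  ultimately show ?thesis using theI'[of "\<lambda>u. u \<in> X \<and> v - u \<in> orth X"] by simp
qed

context
  fixes X
  assumes X: "subspace X"
begin

lemma proj_in: "proj X v \<in> X"
  and diff_proj_in_orth: "v - proj X v \<in> orth X"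
  using proj_props[OF X] by auto

lemma proj_eqI: "u \<in> X \<Longrightarrow> v - u \<in> orth X \<Longrightarrow> proj X v = u"
  by (rule proj_unique[OF X proj_in diff_proj_in_orth])

lemma proj_eq_self_iff: "proj X v = v \<longleftrightarrow> v \<in> X"
  using proj_in[of v] proj_eqI[of v v] subspace_0[OF subspace_orth_set] by auto

lemma proj_proj: "proj X (proj X v) = proj X v"
  using proj_eq_self_iff proj_in by simp

lemma proj_eq_0_iff: "proj X v = 0 \<longleftrightarrow> v \<in> orth X"
  using diff_proj_in_orth[of v] proj_eqI[of 0 v] subspace_0[OF X] by auto

lemma lin_proj: "lin (proj X)"
proof (rule linI)
  fix x y a
  have "(x - proj X x) + (y - proj X y) \<in> orth X"
    by (intro subspace_add subspace_orth_set diff_proj_in_orth)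
  then show "proj X (x + y) = proj X x + proj X y"
    by (intro proj_eqI subspace_add X proj_in) (simp add: algebra_simps)
  have "scale a (x - proj X x) \<in> orth X"
    by (intro subspace_scale subspace_orth_set diff_proj_in_orth)
  then show "proj X (scale a x) = scale a (proj X x)"
    by (intro proj_eqI subspace_scale X proj_in) (simp add: scale_right_diff_distrib)
qed

lemma self_adj_proj: "self_adj (proj X)"
  unfolding self_adj_def
proof (intro conjI allI lin_proj)
  fix x y
  have "ip (y - proj X y) (proj X x) = 0" "ip (x - proj X x) (proj X y) = 0"
    using diff_proj_in_orth proj_in unfolding orth_def by blast+
  then have "ip (proj X x) (y - proj X y) = 0" "ip x (proj X y) = ip (proj X x) (proj X y)"
    by (simp_all only: ip_eq_0_commute[of "proj X x"] ip_diff_left right_minus_eq)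
  then show "ip (proj X x) y = ip x (proj X y)" by (simp add: ip_diff_right)
qed

lemma rip_proj: "rip (proj X x) x = sq (proj X x)"
  using self_adj_rip[OF self_adj_proj, of "proj X x" x] by (simp only: proj_proj)

lemma sq_diff_proj: "sq (x - proj X x) = sq x - sq (proj X x)"
  using rip_proj[of x] by (simp add: rip_diff_left rip_diff_right rip_commute[of x "proj X x"])

lemma sq_proj_le: "sq (proj X x) \<le> sq x"
  using sq_diff_proj[of x] sq_nonneg[of "x - proj X x"] by linarith

lemma orth_orth: "orth (orth X) = X"
proof
  show "X \<subseteq> orth (orth X)" unfolding orth_def using ip_eq_0_commute by blast
  show "orth (orth X) \<subseteq> X"
  proof
    fix v assume v: "v \<in> orth (orth X)"
    let ?d = "v - proj X v"
    have d: "?d \<in> orth X" by (rule diff_proj_in_orth)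
    then have "ip ?d (proj X v) = 0" using proj_in unfolding orth_def by blast
    moreover have "ip v ?d = 0" using v d unfolding orth_def by blast
    then have "ip ?d v = 0" by (simp only: ip_eq_0_commute[of ?d])
    ultimately have "ip ?d ?d = 0" by (simp add: ip_diff_right[of ?d v])
    then have "proj X v = v" by (simp add: ip_self_eq_0)
    then show "v \<in> X" by (simp only: proj_eq_self_iff)
  qed
qed

lemma proj_orth: "proj (orth X) v = v - proj X v"
proof -
  have "proj X v \<in> orth (orth X)" using proj_in orth_orth by simp
  then show ?thesis
    using proj_unique[OF subspace_orth_set[of X], of "proj (orth X) v" v "v - proj X v"]
      proj_props[OF subspace_orth_set[of X]] diff_proj_in_orth by simp
qed

lemma inter_orth: "X \<inter> orth X = {0}"
  using subspace_0[OF X] subspace_0[OF subspace_orth_set] ip_self_eq_0 by (auto simp: orth_def)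

lemma dim_orth: "dim X + dim (orth X) = dim UNIV"
proof -
  have "v \<in> {x + y |x y. x \<in> X \<and> y \<in> orth X}" for v
  proof -
    have "v = proj X v + (v - proj X v)" by simp
    then show ?thesis using proj_in diff_proj_in_orth by blast
  qed
  then have "{x + y |x y. x \<in> X \<and> y \<in> orth X} = UNIV" by blast
  moreover have "dim (X \<inter> orth X) = 0" by (simp only: inter_orth dim_eq_0)
  ultimately show ?thesis
    using dim_sums_Int[OF X subspace_orth_set[of X]] by (simp only: add_0_right)
qed

end

text \<open>\<open>orth X \<inter> orth Z\<close> is the complement of the sum of \<open>X\<close>
  and \<open>Z\<close>. The equation measures how far the multiplicity of -1 departs from that of 1
  in the spectrum of \<open>proj_sum X Z\<close>.\<close>

lemma dim_orth_inter_orth: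
  assumes X: "subspace X" and Z: "subspace Z"
  shows "dim (orth X \<inter> orth Z) + dim X + dim Z = dim UNIV + dim (X \<inter> Z)"
proof -
  let ?S = "{x + z |x z. x \<in> X \<and> z \<in> Z}"
  have S: "subspace ?S" by (rule subspace_sums[OF X Z])
  have e: "orth ?S = orth X \<inter> orth Z"
  proof
    have "X \<subseteq> ?S" "Z \<subseteq> ?S"
      using subspace_0[OF X] subspace_0[OF Z] by force+
    then show "orth ?S \<subseteq> orth X \<inter> orth Z" unfolding orth_def by blast
    show "orth X \<inter> orth Z \<subseteq> orth ?S" by (auto simp: orth_def ip_add_right)
  qed
  show ?thesis
    using dim_orth[OF S] dim_sums_Int[OF X Z] unfolding e by linarith
qed

text \<open>The operator \<open>A\<^sup>* A\<close> for \<open>A = proj X \<circ> proj Z\<close>;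
  its eigenvalues are the squared cosines.\<close>

definition gram :: "'v set \<Rightarrow> 'v set \<Rightarrow> 'v \<Rightarrow> 'v" where
  "gram X Z v = proj Z (proj X (proj Z v))"

text \<open>The operator C_X of the overview; in the difference for two subspaces \<open>X\<close>
  the terms in \<open>Z\<close> cancel.\<close>

definition proj_sum :: "'v set \<Rightarrow> 'v set \<Rightarrow> 'v \<Rightarrow> 'v" where
  "proj_sum X Z v = proj X v + proj Z v - v"

lemma adj_proj_comp:
  assumes X: "subspace X" and Z: "subspace Z"
  shows "adj (proj X \<circ> proj Z) = proj Z \<circ> proj X"
proof -
  have eq: "ip ((proj X \<circ> proj Z) x) y = ip x ((proj Z \<circ> proj X) y)" for x y
    by (simp add: self_adj_ip[OF self_adj_proj] X Z)
  show ?thesis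
    unfolding adj_def
  proof (rule the_equality)
    show "\<forall>x y. ip ((proj X \<circ> proj Z) x) y = ip x ((proj Z \<circ> proj X) y)"
      using eq by blast
    fix B assume B: "\<forall>x y. ip ((proj X \<circ> proj Z) x) y = ip x (B y)"
    show "B = proj Z \<circ> proj X"
    proof
      fix y
      show "B y = (proj Z \<circ> proj X) y" by (rule ip_right_eqI) (metis B eq)
    qed
  qed
qed

text \<open>Multiplicities are compared by exhibiting such maps in both directions between two
  eigenspaces.\<close>

lemma dim_le_inj:
  assumes f: "lin f" and S: "subspace S" and "f ` S \<subseteq> T"
    and ker: "\<And>x. x \<in> S \<Longrightarrow> f x = 0 \<Longrightarrow> x = 0"
  shows "dim S \<le> dim T"
  using dim_image_lin[OF f S ker] dim_subset[OF assms(3)] by simp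

lemma subspace_eigenspace:
  assumes "lin A"
  shows "subspace {v. A v = scale a v}"
  by (rule subspaceI)
    (simp_all add: lin_0[OF assms] lin_add[OF assms] lin_scale[OF assms] scale_right_distrib mult.commute)

section \<open>Spectra of P_Z P_X P_Z and of P_X + P_Z - 1\<close>

context
  fixes X Z
  assumes X: "subspace X" and Z: "subspace Z"
begin

lemmas proj_lin_simps =
  lin_add[OF lin_proj[OF X]] lin_diff[OF lin_proj[OF X]] lin_scale[OF lin_proj[OF X]]
  lin_add[OF lin_proj[OF Z]] lin_diff[OF lin_proj[OF Z]] lin_scale[OF lin_proj[OF Z]]
  proj_proj[OF X] proj_proj[OF Z]

lemma sv_mult_proj_comp: "sv_mult (proj X \<circ> proj Z) s = dim {v. gram X Z v = scale (of_real (s\<^sup>2)) v}"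
  unfolding sv_mult_def adj_proj_comp[OF X Z] by (simp add: gram_def proj_proj[OF X])

lemma self_adj_gram: "self_adj (gram X Z)"
  unfolding self_adj_def
proof (intro conjI allI)
  show "lin (gram X Z)" by (rule linI) (simp_all add: gram_def proj_lin_simps)
  show "ip (gram X Z x) y = ip x (gram X Z y)" for x y
    by (simp add: gram_def self_adj_ip[OF self_adj_proj] X Z)
qed

lemma self_adj_proj_sum: "self_adj (proj_sum X Z)"
proof -
  have "self_adj (\<lambda>x. (proj X x + proj Z x) - scale (of_real 1) x)"
    by (intro self_adj_diff self_adj_add self_adj_proj self_adj_scale X Z)
  then show ?thesis by (simp add: proj_sum_def[abs_def])
qed

lemma rip_gram: "rip (gram X Z v) v = sq (proj X (proj Z v))"
proof -
  have "rip (gram X Z v) v = rip (proj X (proj Z v)) (proj Z v)"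
    unfolding gram_def by (rule self_adj_rip[OF self_adj_proj[OF Z]])
  then show ?thesis by (simp add: rip_proj[OF X])
qed

lemma gram_eigenvector_in:
  assumes "gram X Z v = scale a v" "a \<noteq> 0"
  shows "v \<in> Z"
proof -
  have "v = scale (1 / a) (gram X Z v)" using assms by simp
  also have "\<dots> \<in> Z" unfolding gram_def by (intro subspace_scale Z proj_in)
  finally show ?thesis .
qed

lemma proj_eigenvector_0:
  assumes "proj X v = scale a v" "a \<noteq> 0" "a \<noteq> 1"
  shows "v = 0"
proof -
  have "scale a v = scale (a * a) v"
    using proj_proj[OF X, of v] assms(1) by (simp add: lin_scale[OF lin_proj[OF X]])
  then have "a = a * a \<or> v = 0" by (simp only: scale_cancel_right)
  then show ?thesis using assms(2,3) by simp
qed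

text \<open>The square of \<open>proj_sum X Z\<close> is P_X P_Z + P_Z P_X - P_X - P_Z + 1; a
  further P_Z in front cancels everything but P_Z P_X P_Z.\<close>

lemma proj_sum_proj_sum: "proj Z (proj_sum X Z (proj_sum X Z v)) = gram X Z v"
  by (simp add: proj_sum_def gram_def proj_lin_simps)

lemma proj_sum_proj_sum_in: "v \<in> Z \<Longrightarrow> proj_sum X Z (proj_sum X Z v) = gram X Z v"
  using proj_eq_self_iff[OF Z, of v] by (simp add: proj_sum_def gram_def proj_lin_simps)

text \<open>\<open>proj Z\<close> maps the first eigenspace into the second, and C + s with C =
  \<open>proj_sum X Z\<close> maps back. A vector killed by either map would be an eigenvector of
  \<open>proj X\<close> for 1 + s or for -s, and both numbers differ from 0 and 1 exactly because s
  is neither 0 nor -1.\<close>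

lemma dim_eigenspace_proj_sum:
  assumes s: "s \<noteq> 0" "s \<noteq> -1"
  shows "dim {v. proj_sum X Z v = scale (of_real s) v} = dim {v. gram X Z v = scale (of_real (s\<^sup>2)) v}"
    (is "dim ?C = dim ?T")
proof (rule antisym)
  have linC: "lin (proj_sum X Z)" and linT: "lin (gram X Z)"
    using self_adj_lin self_adj_proj_sum self_adj_gram by blast+
  show "dim ?C \<le> dim ?T"
  proof (rule dim_le_inj[OF lin_proj[OF Z]])
    show "subspace ?C" using subspace_eigenspace[OF linC] .
    show "proj Z ` ?C \<subseteq> ?T"
    proof clarify
      fix v assume v: "proj_sum X Z v = scale (of_real s) v"
      have "gram X Z (proj Z v) = gram X Z v" by (simp add: gram_def proj_lin_simps)
      also have "\<dots> = proj Z (proj_sum X Z (scale (of_real s) v))" by (simp only: proj_sum_proj_sum[symmetric] v)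
      also have "\<dots> = scale (of_real (s\<^sup>2)) (proj Z v)"
        by (simp add: lin_scale[OF linC] v power2_eq_square lin_scale[OF lin_proj[OF Z]])
      finally show "gram X Z (proj Z v) = scale (of_real (s\<^sup>2)) (proj Z v)" .
    qed
    fix v assume "v \<in> ?C" "proj Z v = 0"
    then have "proj X v - v = scale (of_real s) v" by (simp add: proj_sum_def)
    then have "proj X v = scale (1 + of_real s) v" by (simp add: scale_left_distrib algebra_simps)
    moreover have "1 + of_real s \<noteq> (0 :: 'k)" "1 + of_real s \<noteq> (1 :: 'k)"
      using s by (auto simp: add_eq_0_iff) (metis of_real_1 of_real_eq_iff of_real_minus minus_minus)+
    ultimately show "v = 0" by (rule proj_eigenvector_0)
  qed
  show "dim ?T \<le> dim ?C"
  proof (rule dim_le_inj[where f = "\<lambda>v. proj_sum X Z v + scale (of_real s) v"])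
    show "lin (\<lambda>v. proj_sum X Z v + scale (of_real s) v)"
      by (intro self_adj_lin self_adj_add self_adj_proj_sum self_adj_scale)
    show "subspace ?T" using subspace_eigenspace[OF linT] .
    have inZ: "v \<in> Z" if "v \<in> ?T" for v
      using that s gram_eigenvector_in[of v "of_real (s\<^sup>2)"] by simp
    show "(\<lambda>v. proj_sum X Z v + scale (of_real s) v) ` ?T \<subseteq> ?C"
    proof clarify
      fix v assume v: "gram X Z v = scale (of_real (s\<^sup>2)) v"
      \<comment> \<open>On \<open>Z\<close> the operator C squares to the Gram operator, so (C -
        s)(C + s) annihilates \<open>v\<close>.\<close>
      then have "proj_sum X Z (proj_sum X Z v) = scale (of_real s) (scale (of_real s) v)"
        using inZ proj_sum_proj_sum_in by (simp add: power2_eq_square)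
      then show "proj_sum X Z (proj_sum X Z v + scale (of_real s) v)
          = scale (of_real s) (proj_sum X Z v + scale (of_real s) v)"
        by (simp only: lin_add[OF linC] lin_scale[OF linC] scale_right_distrib add.commute)
    qed
    fix v assume v: "v \<in> ?T" "proj_sum X Z v + scale (of_real s) v = 0"
    have "proj Z v = v" using inZ[OF v(1)] by (simp add: proj_eq_self_iff[OF Z])
    then have "proj X v + scale (of_real s) v = 0" using v(2) by (simp add: proj_sum_def)
    then have "proj X v = scale (of_real (- s)) v" by (simp add: eq_neg_iff_add_eq_0)
    moreover have "of_real (- s) \<noteq> (0 :: 'k)" "of_real (- s) \<noteq> (1 :: 'k)"
      using s by (auto simp only: of_real_eq_0_iff of_real_eq_1_iff)
    ultimately show "v = 0" by (rule proj_eigenvector_0)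
  qed
qed

text \<open>A fixed vector lies in \<open>Z\<close> and is not shortened by \<open>proj X\<close>,
  so it lies in \<open>X\<close> too.\<close>

lemma gram_fixed: "{v. gram X Z v = v} = X \<inter> Z"
proof
  show "X \<inter> Z \<subseteq> {v. gram X Z v = v}"
    by (auto simp: gram_def proj_eq_self_iff[OF X, THEN iffD2] proj_eq_self_iff[OF Z, THEN iffD2])
  show "{v. gram X Z v = v} \<subseteq> X \<inter> Z"
  proof clarify
    fix v assume v: "gram X Z v = v"
    then have vZ: "v \<in> Z" using gram_eigenvector_in[of v 1] by simp
    then have "sq v = sq (proj X v)"
      using rip_gram[of v] v proj_eq_self_iff[OF Z, of v] by simp
    then have "v - proj X v = 0" using sq_diff_proj[OF X, of v] by (metis diff_self sq_eq_0)
    then show "v \<in> X \<inter> Z" using vZ proj_eq_self_iff[OF X, of v] by simp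
  qed
qed

text \<open>Pairing P_X v + P_Z v = 0 with v gives a vanishing sum of two squared norms.\<close>

lemma proj_sum_minus: "{v. proj_sum X Z v = - v} = orth X \<inter> orth Z"
proof
  show "orth X \<inter> orth Z \<subseteq> {v. proj_sum X Z v = - v}"
    by (auto simp: proj_sum_def simp flip: proj_eq_0_iff[OF X] proj_eq_0_iff[OF Z])
  show "{v. proj_sum X Z v = - v} \<subseteq> orth X \<inter> orth Z"
  proof clarify
    fix v assume "proj_sum X Z v = - v"
    then have "proj X v + proj Z v = 0" by (simp add: proj_sum_def)
    then have "sq (proj X v) + sq (proj Z v) = 0"
      by (metis rip_proj[OF X] rip_proj[OF Z] rip_add_left ip_0_left rip_def scal_re_0)
    then have "sq (proj X v) = 0" "sq (proj Z v) = 0"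
      using sq_nonneg[of "proj X v"] sq_nonneg[of "proj Z v"] by linarith+
    then show "v \<in> orth X \<inter> orth Z" by (simp add: proj_eq_0_iff X Z)
  qed
qed

text \<open>The kernel is the direct sum of \<open>orth Z\<close> and
  \<open>orth X \<inter> Z\<close>. Its dimension serves to count the positive cosines.\<close>

lemma dim_ker_gram: "dim {v. gram X Z v = 0} + dim Z = dim UNIV + dim (orth X \<inter> Z)"
proof -
  let ?K = "{v. gram X Z v = 0}" and ?U = "orth X \<inter> Z"
  have U: "subspace ?U" by (intro subspace_inter subspace_orth_set Z)
  have K: "gram X Z v = 0 \<longleftrightarrow> proj Z v \<in> orth X" for v
  proof
    assume "gram X Z v = 0"
    then have "sq (proj X (proj Z v)) = 0" using rip_gram[of v] by (simp add: rip_def)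
    then show "proj Z v \<in> orth X" by (simp add: proj_eq_0_iff X)
  next
    assume "proj Z v \<in> orth X"
    then show "gram X Z v = 0"
      by (simp add: gram_def lin_0[OF lin_proj[OF Z]] proj_eq_0_iff[OF X, THEN iffD2])
  qed
  have e: "{x + y |x y. x \<in> orth Z \<and> y \<in> ?U} = ?K"
  proof (rule subset_antisym; rule subsetI)
    fix v assume "v \<in> {x + y |x y. x \<in> orth Z \<and> y \<in> ?U}"
    then obtain x y where v: "v = x + y" "proj Z x = 0" "y \<in> orth X" "y \<in> Z"
      by (auto simp: proj_eq_0_iff Z)
    then have "proj Z v = y" by (simp add: proj_lin_simps proj_eq_self_iff[OF Z, THEN iffD2])
    then show "v \<in> ?K" using v K by simp
  next
    fix v assume "v \<in> ?K"
    then have "proj Z v \<in> ?U" using K proj_in[OF Z] by simp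
    moreover have "v - proj Z v \<in> orth Z" by (rule diff_proj_in_orth[OF Z])
    moreover have "v = (v - proj Z v) + proj Z v" by simp
    ultimately show "v \<in> {x + y |x y. x \<in> orth Z \<and> y \<in> ?U}" by blast
  qed
  have "orth Z \<inter> ?U \<subseteq> {0}" using inter_orth[OF Z] by blast
  then have d: "dim (orth Z \<inter> ?U) = 0" by (simp only: dim_eq_0)
  show ?thesis
    using dim_sums_Int[OF subspace_orth_set[of Z] U] dim_orth[OF Z] unfolding e d by linarith
qed

end

text \<open>This is sin^2 + cos^2 = 1 at the level of multiplicities. The eigenvectors on the two
  sides lie in \<open>orth Z\<close> and in \<open>Z\<close>, so the passage goes through
  \<open>proj_sum X (orth Z)\<close>, which is the negative of \<open>proj_sum (orth X) Z\<close>;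
  on \<open>Z\<close> the operator \<open>gram (orth X) Z\<close> is the identity minus
  \<open>gram X Z\<close>.\<close>

lemma dim_eigenspace_gram_orth:
  assumes X: "subspace X" and Z: "subspace Z" and s: "0 < s" "s < 1"
  shows "dim {v. gram X (orth Z) v = scale (of_real (s\<^sup>2)) v} =
    dim {v. gram X Z v = scale (of_real (1 - s\<^sup>2)) v}"
proof -
  have "dim {v. gram X (orth Z) v = scale (of_real (s\<^sup>2)) v}
      = dim {v. proj_sum X (orth Z) v = scale (of_real s) v}"
    using dim_eigenspace_proj_sum[OF X subspace_orth_set, of s Z] s by simp
  also have "{v. proj_sum X (orth Z) v = scale (of_real s) v}
      = {v. proj_sum (orth X) Z v = scale (of_real (- s)) v}"
  proof -
    have "proj_sum (orth X) Z v = - proj_sum X (orth Z) v" for v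
      by (simp add: proj_sum_def proj_orth X Z)
    then show ?thesis by (simp add: minus_equation_iff) (metis minus_minus)
  qed
  also have "dim \<dots> = dim {v. gram (orth X) Z v = scale (of_real ((- s)\<^sup>2)) v}"
    using s by (intro dim_eigenspace_proj_sum subspace_orth_set Z) auto
  also have "{v. gram (orth X) Z v = scale (of_real ((- s)\<^sup>2)) v}
      = {v. gram X Z v = scale (of_real (1 - s\<^sup>2)) v}"
  proof -
    have g: "gram (orth X) Z v = proj Z v - gram X Z v" for v
      by (simp add: gram_def proj_orth X Z lin_diff[OF lin_proj[OF Z]] proj_proj)
    have "s\<^sup>2 \<noteq> 0" "1 - s\<^sup>2 \<noteq> 0" using s by (auto simp: power2_eq_1_iff)
    then have nz: "of_real ((- s)\<^sup>2) \<noteq> (0 :: 'k)" "of_real (1 - s\<^sup>2) \<noteq> (0 :: 'k)"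
      by (simp_all only: of_real_eq_0_iff power2_minus not_False_eq_True)
    have "gram (orth X) Z v = scale (of_real ((- s)\<^sup>2)) v
        \<longleftrightarrow> gram X Z v = scale (of_real (1 - s\<^sup>2)) v" for v
    proof (cases "v \<in> Z")
      case True
      then have "gram (orth X) Z v = v - gram X Z v" using g proj_eq_self_iff[OF Z] by simp
      moreover have "scale (of_real (1 - s\<^sup>2)) v = v - scale (of_real ((- s)\<^sup>2)) v"
        by (simp add: scale_left_diff_distrib)
      moreover have "v - x = y \<longleftrightarrow> x = v - y" for x y by (auto simp: algebra_simps)
      ultimately show ?thesis by (simp only:)
    next
      case False
      \<comment> \<open>Both eigenvalues are nonzero, so neither operator has such an eigenvector
        outside \<open>Z\<close>.\<close>
      then show ?thesis
        using nz gram_eigenvector_in[OF subspace_orth_set Z] gram_eigenvector_in[OF X Z] by blast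
    qed
    then show ?thesis by blast
  qed
  finally show ?thesis .
qed

end

section \<open>Singular values of a product of projections\<close>

text \<open>A superlevel set of a nonincreasing sequence is an initial segment, finite since the
  sequence ends in zeros and s is positive; its cardinality therefore determines it.\<close>

lemma antimono_superlevel:
  fixes f :: "nat \<Rightarrow> real"
  assumes "antimono f" "\<And>i. N \<le> i \<Longrightarrow> f i = 0" "0 < s"
  shows "s \<le> f i \<longleftrightarrow> i < card {i. s \<le> f i}"
proof -
  let ?S = "{i. s \<le> f i}"
  have sub: "?S \<subseteq> {..<N}"
  proof
    fix j assume "j \<in> ?S"
    then have "f j \<noteq> 0" using assms(3) by auto
    then show "j \<in> {..<N}" using assms(2)[of j] by force
  qed
  then have fin: "finite ?S" using finite_subset by blast
  show ?thesis
  proof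
    assume "s \<le> f i"
    then have "{..i} \<subseteq> ?S" using antimonoD[OF assms(1)] by (auto intro: order_trans)
    then have "card {..i} \<le> card ?S" using fin by (intro card_mono)
    then show "i < card ?S" by simp
  next
    assume i: "i < card ?S"
    show "s \<le> f i"
    proof (rule ccontr)
      assume "\<not> s \<le> f i"
      then have "?S \<subseteq> {..<i}" using antimonoD[OF assms(1)] by (force simp: not_le intro: le_less_trans)
      then have "card ?S \<le> card {..<i}" by (intro card_mono) auto
      then show False using i by simp
    qed
  qed
qed

text \<open>The value 1 is counted separately because its multiplicity is the one allowed to differ
  between the sequences compared below. \<open>V\<close> may contain values that do not occur, so
  that one set can serve two sequences.\<close>

lemma card_superlevel:
  fixes f :: "nat \<Rightarrow> real"
  assumes "\<And>i. N \<le> i \<Longrightarrow> f i = 0" "\<And>i. f i \<le> 1" "0 < s" "s \<le> 1"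
    and V: "finite V" "f ` {i. s \<le> f i} \<subseteq> insert 1 V" "V \<subseteq> {s..<1}"
  shows "card {i. s \<le> f i} = card {i. f i = 1} + (\<Sum>v\<in>V. card {i. f i = v})"
proof -
  have fin: "finite {i. f i = v}" if "0 < v" for v
  proof (rule finite_subset)
    show "{i. f i = v} \<subseteq> {..<N}"
    proof
      fix j assume "j \<in> {i. f i = v}"
      then have "f j \<noteq> 0" using that by auto
      then show "j \<in> {..<N}" using assms(1)[of j] by force
    qed
  qed simp
  have "{i. s \<le> f i} = (\<Union>v\<in>insert 1 V. {i. f i = v})"
    using V(2,3) assms(4) by auto
  then have "card {i. s \<le> f i} = (\<Sum>v\<in>insert 1 V. card {i. f i = v})"
    using V assms(3) fin by (simp only:) (rule card_UN_disjoint, auto)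
  then show ?thesis using V by (subst (asm) sum.insert) auto
qed

text \<open>A nonincreasing sequence in \<open>[0, 1]\<close> is determined by the multiplicities of its positive
  values; changing the multiplicity of the largest possible value 1 shifts it.\<close>

lemma antimono_shift_eq:
  fixes f g :: "nat \<Rightarrow> real"
  assumes f: "antimono f" "\<And>i. N \<le> i \<Longrightarrow> f i = 0" "\<And>i. f i \<le> 1" "\<And>i. 0 \<le> f i"
    and g: "antimono g" "\<And>i. N \<le> i \<Longrightarrow> g i = 0" "\<And>i. g i \<le> 1" "\<And>i. 0 \<le> g i"
    and eq: "\<And>s. 0 < s \<Longrightarrow> s < 1 \<Longrightarrow> card {i. f i = s} = card {i. g i = s}"
    and one: "card {i. f i = 1} + a = card {i. g i = 1} + b"
  shows "f (i + b) = g (i + a)"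
proof -
  \<comment> \<open>Two nonnegative numbers are equal if they reach the same positive
    thresholds.\<close>
  have "s \<le> f (i + b) \<longleftrightarrow> s \<le> g (i + a)" if s: "0 < s" for s
  proof (cases "s \<le> 1")
    case True
    define V where "V = (f ` {..<N} \<union> g ` {..<N}) \<inter> {s..<1}"
    have V: "finite V" "V \<subseteq> {s..<1}" by (auto simp: V_def)
    have sub: "h ` {i. s \<le> h i} \<subseteq> insert 1 (h ` {..<N} \<inter> {s..<1})"
      if h: "\<And>i. N \<le> i \<Longrightarrow> h i = 0" "\<And>i. h i \<le> 1" for h :: "nat \<Rightarrow> real"
    proof (rule image_subsetI)
      fix i assume "i \<in> {i. s \<le> h i}"
      then have i: "s \<le> h i" by simp
      have "i < N" using h(1)[of i] i s by (cases "i < N") auto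
      then show "h i \<in> insert 1 (h ` {..<N} \<inter> {s..<1})" using i h(2)[of i] by auto
    qed
    have fV: "f ` {i. s \<le> f i} \<subseteq> insert 1 V" and gV: "g ` {i. s \<le> g i} \<subseteq> insert 1 V"
      using sub[of f, OF f(2,3)] sub[of g, OF g(2,3)] unfolding V_def by blast+
    have "(\<Sum>v\<in>V. card {i. f i = v}) = (\<Sum>v\<in>V. card {i. g i = v})"
      using V s by (intro sum.cong refl eq) auto
    then have "card {i. s \<le> f i} + a = card {i. s \<le> g i} + b"
      using card_superlevel[OF f(2,3) s True V(1) fV V(2)] card_superlevel[OF g(2,3) s True V(1) gV V(2)] one
      by simp
    then have "i + b < card {i. s \<le> f i} \<longleftrightarrow> i + a < card {i. s \<le> g i}" by linarith
    then show ?thesis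
      using antimono_superlevel[where N = N and i = "i + b", OF f(1,2) s]
        antimono_superlevel[where N = N and i = "i + a", OF g(1,2) s]
      by blast
  next
    case False
    then show ?thesis using f(3)[of "i + b"] g(3)[of "i + a"] by linarith
  qed
  from this[of "f (i + b)"] this[of "g (i + a)"] show ?thesis
    using f(4)[of "i + b"] g(4)[of "i + a"] by (cases "f (i + b) = 0"; cases "g (i + a) = 0") force+
qed

lemma antimono_pos_part:
  assumes "antimono_on {..<n} l"
  shows "antimono (pos_part n l)"
proof (rule antimonoI)
  fix i j :: nat assume "i \<le> j"
  then show "pos_part n l j \<le> pos_part n l i"
    using monotone_onD[OF assms, of i j] by (auto simp: pos_part_def)
qed

lemma antimono_neg_part:
  assumes "antimono_on {..<n} l"
  shows "antimono (neg_part n l)"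
proof (rule antimonoI)
  fix i j :: nat assume ij: "i \<le> j"
  then have "n - Suc j \<le> n - Suc i" by simp
  then show "neg_part n l j \<le> neg_part n l i"
    using monotone_onD[OF assms, of "n - Suc j" "n - Suc i"] ij by (auto simp: neg_part_def)
qed

lemma card_pos_part:
  assumes "0 < s"
  shows "card {i. pos_part n l i = s} = card {i. i < n \<and> l i = s}"
  using assms by (intro arg_cong[where f = card]) (auto simp: pos_part_def max_def)

lemma card_neg_part:
  assumes "0 < s"
  shows "card {i. neg_part n l i = s} = card {i. i < n \<and> l i = - s}"
proof (rule bij_betw_same_card[of "\<lambda>i. n - Suc i"])
  show "bij_betw (\<lambda>i. n - Suc i) {i. neg_part n l i = s} {i. i < n \<and> l i = - s}"
    by (rule bij_betw_byWitness[where f' = "\<lambda>i. n - Suc i"])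
      (use assms in \<open>auto simp: neg_part_def max_def split: if_splits\<close>)
qed

lemma rev_sorted_list_of_mset_eq:
  fixes xs :: "real list"
  assumes "sorted (rev xs)"
  shows "rev (sorted_list_of_multiset (mset xs)) = xs"
proof -
  have "sorted_list_of_multiset (mset xs) = sort xs" by (simp add: sorted_list_of_multiset_mset)
  also have "sort xs = rev xs" using assms by (intro properties_for_sort) simp_all
  finally show ?thesis by simp
qed

section \<open>Cosines as eigenvalues\<close>

context ip_space
begin

lemma eigsys_antimono_on: "eigsys A e l \<Longrightarrow> antimono_on {..<dim UNIV} l"
  by (simp only: eigsys_def)

lemma rip_eigenvector:
  assumes "eigsys A e l" "i < dim UNIV"
  shows "l i = rip (A (e i)) (e i)" "sq (e i) = 1"
proof -
  show sq: "sq (e i) = 1"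
    using orthonormal_sq[OF eigsys_orthonormal[OF assms(1)]] assms(2) by blast
  show "l i = rip (A (e i)) (e i)"
    by (simp only: eigsys_eigenvector[OF assms] rip_scale_left sq mult_1_right)
qed

text \<open>All singular values are kept and continued by zeros, so that the sequences for
  \<open>Z\<close> and \<open>orth Z\<close>, which have different numbers of angles, can be
  compared at shifted indices.\<close>

definition cos_seq :: "'v set \<Rightarrow> 'v set \<Rightarrow> nat \<Rightarrow> real" where
  "cos_seq X Z i = (let s = singular_values (proj X \<circ> proj Z) in if i < length s then s ! i else 0)"

context
  fixes X Z
  assumes X: "subspace X" and Z: "subspace Z"
begin

lemma gram_eigenvalue_bounds:
  assumes "eigsys (gram X Z) e l" "i < dim UNIV"
  shows "0 \<le> l i" "l i \<le> 1"
proof -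
  have l: "l i = sq (proj X (proj Z (e i)))" "sq (e i) = 1"
    using rip_eigenvector[OF assms] rip_gram[OF X Z] by simp_all
  then show "0 \<le> l i" by simp
  show "l i \<le> 1" using l sq_proj_le[OF X, of "proj Z (e i)"] sq_proj_le[OF Z, of "e i"] by simp
qed

lemma singular_values_eq:
  assumes es: "eigsys (gram X Z) e l"
  shows "singular_values (proj X \<circ> proj Z) = map (\<lambda>i. sqrt (l i)) [0..<dim UNIV]"
proof -
  define n where "n = dim UNIV"
  let ?L = "map (\<lambda>i. sqrt (l i)) [0..<n]"
  have mult: "sv_mult (proj X \<circ> proj Z) s = card {i. i < n \<and> l i = s\<^sup>2}" for s
    unfolding sv_mult_proj_comp[OF X Z] dim_eigenspace[OF es] n_def ..
  have l0: "0 \<le> l i" if "i < n" for i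
    using gram_eigenvalue_bounds(1)[OF es] that by (simp only: n_def)
  have count: "count (mset ?L) s = (if s \<ge> 0 then sv_mult (proj X \<circ> proj Z) s else 0)" for s
  proof -
    have "count (mset ?L) s = length (filter ((=) s) ?L)"
      by (simp only: count_mset count_list_eq_length_filter)
    also have "\<dots> = card {i. i < length ?L \<and> s = ?L ! i}" by (rule length_filter_conv_card)
    also have "{i. i < length ?L \<and> s = ?L ! i} = {i. i < n \<and> sqrt (l i) = s}" by auto
    also have "card \<dots> = (if s \<ge> 0 then sv_mult (proj X \<circ> proj Z) s else 0)"
    proof (cases "s \<ge> 0")
      case True
      have "{i. i < n \<and> sqrt (l i) = s} = {i. i < n \<and> l i = s\<^sup>2}"
        using l0 True by (auto simp: real_sqrt_unique)
      then show ?thesis using True mult by simp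
    next
      case False
      have "{i. i < n \<and> sqrt (l i) = s} = {}" using l0 False by force
      then show ?thesis using False by simp
    qed
    finally show ?thesis .
  qed
  let ?S = "{s. s \<ge> 0 \<and> sv_mult (proj X \<circ> proj Z) s > 0}"
  have "?S \<subseteq> set ?L"
  proof
    fix s assume "s \<in> ?S"
    then have "count (mset ?L) s > 0" unfolding count by simp
    then show "s \<in> set ?L" by (simp only: count_greater_zero_iff set_mset_mset)
  qed
  \<comment> \<open>Finiteness matters: over an infinite index set the sum in the definition would
    be empty by convention.\<close>
  then have fin: "finite ?S" using finite_subset by blast
  have "(\<Sum>s\<in>?S. replicate_mset (sv_mult (proj X \<circ> proj Z) s) s) = mset ?L"
  proof (rule multiset_eqI)
    fix x
    have "count (\<Sum>s\<in>?S. replicate_mset (sv_mult (proj X \<circ> proj Z) s) s) x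
        = (\<Sum>s\<in>?S. if s = x then sv_mult (proj X \<circ> proj Z) s else 0)"
      by (simp add: count_sum eq_commute[of x])
    also have "\<dots> = (if x \<in> ?S then sv_mult (proj X \<circ> proj Z) x else 0)"
      using fin by simp
    also have "\<dots> = count (mset ?L) x" unfolding count by simp
    finally show "count (\<Sum>s\<in>?S. replicate_mset (sv_mult (proj X \<circ> proj Z) s) s) x = count (mset ?L) x" .
  qed
  moreover have "sorted (rev ?L)"
    unfolding sorted_rev_iff_nth_mono using eigsys_antimono[OF es] by (simp add: n_def)
  ultimately show ?thesis
    unfolding singular_values_def n_def[symmetric] by (simp only: rev_sorted_list_of_mset_eq)
qed

lemma length_singular_values: "length (singular_values (proj X \<circ> proj Z)) = dim UNIV"
proof -
  obtain e l where "eigsys (gram X Z) e l" using spectral[OF self_adj_gram[OF X Z]] .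
  from singular_values_eq[OF this] show ?thesis by simp
qed

lemma cos_seq_eq:
  assumes "eigsys (gram X Z) e l"
  shows "cos_seq X Z i = (if i < dim UNIV then sqrt (l i) else 0)"
  unfolding cos_seq_def singular_values_eq[OF assms] by simp

text \<open>Positivity of s keeps the padding zeros out of the counted sets; the last fact counts
  the nonzero entries through the kernel of the Gram operator.\<close>

lemma cos_seq_props:
  shows cos_seq_antimono: "antimono (cos_seq X Z)"
    and cos_seq_0: "\<And>i. dim UNIV \<le> i \<Longrightarrow> cos_seq X Z i = 0"
    and cos_seq_le_1: "\<And>i. cos_seq X Z i \<le> 1"
    and cos_seq_nonneg: "\<And>i. 0 \<le> cos_seq X Z i"
    and card_cos_seq: "\<And>s. 0 < s \<Longrightarrow>
      card {i. cos_seq X Z i = s} = dim {v. gram X Z v = scale (of_real (s\<^sup>2)) v}"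
    and card_cos_seq_pos: "card {i. 0 < cos_seq X Z i} + dim {v. gram X Z v = 0} = dim UNIV"
proof -
  obtain e l where es: "eigsys (gram X Z) e l" using spectral[OF self_adj_gram[OF X Z]] .
  define n where "n = dim UNIV"
  have eq: "cos_seq X Z i = (if i < n then sqrt (l i) else 0)" for i
    unfolding n_def by (rule cos_seq_eq[OF es])
  have b: "0 \<le> l i" "l i \<le> 1" if "i < n" for i
    using gram_eigenvalue_bounds[OF es] that by (simp_all only: n_def)
  show "antimono (cos_seq X Z)"
  proof (rule antimonoI)
    fix i j :: nat assume "i \<le> j"
    then show "cos_seq X Z j \<le> cos_seq X Z i"
      using eigsys_antimono[OF es, of i j] b by (simp add: eq n_def)
  qed
  show "cos_seq X Z i = 0" if "dim UNIV \<le> i" for i using that by (simp add: eq n_def)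
  show "cos_seq X Z i \<le> 1" "0 \<le> cos_seq X Z i" for i using b by (simp_all add: eq)
  show "card {i. cos_seq X Z i = s} = dim {v. gram X Z v = scale (of_real (s\<^sup>2)) v}" if "0 < s" for s
  proof -
    have "{i. cos_seq X Z i = s} = {i. i < n \<and> l i = s\<^sup>2}"
      using b that by (auto simp: eq real_sqrt_unique split: if_splits)
    then show ?thesis unfolding dim_eigenspace[OF es] n_def by simp
  qed
  have "{v. gram X Z v = 0} = {v. gram X Z v = scale (of_real 0) v}" by simp
  then have "dim {v. gram X Z v = 0} = card {i. i < n \<and> l i = 0}"
    unfolding n_def by (simp only: dim_eigenspace[OF es])
  moreover have "{i. 0 < cos_seq X Z i} = {..<n} - {i. i < n \<and> l i = 0}"
    using b by (force simp: eq split: if_splits)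
  moreover have "card {..<n} = card ({..<n} - {i. i < n \<and> l i = 0}) + card {i. i < n \<and> l i = 0}"
  proof -
    have "{i. i < n \<and> l i = 0} \<subseteq> {..<n}" by auto
    then show ?thesis using card_mono[OF finite_lessThan] by (simp add: card_Diff_subset)
  qed
  ultimately show "card {i. 0 < cos_seq X Z i} + dim {v. gram X Z v = 0} = dim UNIV"
    by (simp add: n_def)
qed

lemma card_cos_seq_1: "card {i. cos_seq X Z i = 1} = dim (X \<inter> Z)"
  using card_cos_seq[of 1] gram_fixed[OF X Z] by simp

text \<open>The value 1 is no exception here: \<open>dim_eigenspace_proj_sum\<close> excludes only 0
  and -1, so all positive values have equal multiplicities and no shift arises.\<close>

lemma pos_part_proj_sum:
  assumes es: "eigsys (proj_sum X Z) f m"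
  shows "pos_part (dim UNIV) m = cos_seq X Z"
proof
  fix i
  define n where "n = dim UNIV"
  have le: "m i \<le> 1" if "i < n" for i
  proof -
    have i: "i < dim UNIV" using that by (simp only: n_def)
    have "m i = sq (proj X (f i)) + sq (proj Z (f i)) - sq (f i)"
      using rip_eigenvector(1)[OF es i]
      by (simp add: proj_sum_def rip_diff_left rip_add_left rip_proj X Z)
    then show ?thesis
      using sq_proj_le[OF X, of "f i"] sq_proj_le[OF Z, of "f i"] rip_eigenvector(2)[OF es i] by linarith
  qed
  have card: "card {i. pos_part n m i = s} = card {i. cos_seq X Z i = s}" if "0 < s" for s
    using that dim_eigenspace[OF es, of s] dim_eigenspace_proj_sum[OF X Z, of s]
    by (simp add: card_pos_part card_cos_seq n_def)
  have "pos_part n m (i + 0) = cos_seq X Z (i + 0)"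
  proof (rule antimono_shift_eq[where N = n])
    show "antimono (pos_part n m)"
      unfolding n_def by (intro antimono_pos_part eigsys_antimono_on[OF es])
    show "pos_part n m i \<le> 1" for i using le by (simp add: pos_part_def)
    show "cos_seq X Z i = 0" if "n \<le> i" for i using cos_seq_0 that by (simp only: n_def)
  qed (use card in \<open>auto simp: pos_part_def cos_seq_antimono cos_seq_le_1 cos_seq_nonneg\<close>)
  then show "pos_part (dim UNIV) m i = cos_seq X Z i" by (simp only: n_def add_0_right)
qed

text \<open>For 0 < s < 1 the eigenvalue -s and the cosine s are equally frequent. At s = 1 the
  multiplicities are \<open>dim (orth X \<inter> orth Z)\<close> and
  \<open>dim (X \<inter> Z)\<close>, which accounts for the shifts; truncated subtraction makes at
  least one of them zero.\<close>

lemma neg_part_proj_sum: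
  assumes es: "eigsys (proj_sum X Z) f m"
  shows "neg_part (dim UNIV) m (i + (dim UNIV - (dim X + dim Z)))
    = cos_seq X Z (i + (dim X + dim Z - dim UNIV))"
proof -
  define n where "n = dim UNIV"
  have ge: "- 1 \<le> m i" if "i < n" for i
  proof -
    have i: "i < dim UNIV" using that by (simp only: n_def)
    have "m i = sq (proj X (f i)) + sq (proj Z (f i)) - sq (f i)"
      using rip_eigenvector(1)[OF es i]
      by (simp add: proj_sum_def rip_diff_left rip_add_left rip_proj X Z)
    then show ?thesis
      using rip_eigenvector(2)[OF es i] sq_nonneg[of "proj X (f i)"] sq_nonneg[of "proj Z (f i)"]
      by linarith
  qed
  have card: "card {i. neg_part n m i = s} = dim {v. proj_sum X Z v = scale (of_real (- s)) v}"
    if "0 < s" for s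
    using dim_eigenspace[OF es, of "- s"] card_neg_part[OF that, of n m] by (simp only: n_def)
  have "neg_part n m (i + (n - (dim X + dim Z))) = cos_seq X Z (i + (dim X + dim Z - n))"
  proof (rule antimono_shift_eq[where N = n])
    show "antimono (neg_part n m)"
      unfolding n_def by (intro antimono_neg_part eigsys_antimono_on[OF es])
    show "neg_part n m i \<le> 1" for i using ge[of "n - Suc i"] by (auto simp: neg_part_def)
    show "cos_seq X Z i = 0" if "n \<le> i" for i using cos_seq_0 that by (simp only: n_def)
    show "card {i. neg_part n m i = s} = card {i. cos_seq X Z i = s}" if s: "0 < s" "s < 1" for s
      using card[OF s(1)] card_cos_seq[OF s(1)] dim_eigenspace_proj_sum[OF X Z, of "- s"] s by simp
    have "card {i. neg_part n m i = 1} = dim (orth X \<inter> orth Z)"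
      using card[of 1] proj_sum_minus[OF X Z] by simp
    then show "card {i. neg_part n m i = 1} + (dim X + dim Z - n)
        = card {i. cos_seq X Z i = 1} + (n - (dim X + dim Z))"
      using dim_orth_inter_orth[OF X Z] card_cos_seq_1 unfolding n_def by linarith
  qed (auto simp: neg_part_def cos_seq_antimono cos_seq_le_1 cos_seq_nonneg)
  then show ?thesis by (simp only: n_def)
qed

text \<open>\<open>X \<inter> Z\<close> has at least this dimension. These are the entries that the
  shift in \<open>neg_part_proj_sum\<close> skips.\<close>

lemma cos_seq_eq_1:
  assumes "i < dim X + dim Z - dim UNIV"
  shows "cos_seq X Z i = 1"
proof -
  have "{i. cos_seq X Z i = 1} = {i. 1 \<le> cos_seq X Z i}"
    using cos_seq_le_1 by (auto intro: antisym)
  then have "card {i. 1 \<le> cos_seq X Z i} = dim (X \<inter> Z)" using card_cos_seq_1 by simp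
  then have "i < card {i. 1 \<le> cos_seq X Z i}"
    using assms dim_orth_inter_orth[OF X Z] by linarith
  then have "1 \<le> cos_seq X Z i"
    using antimono_superlevel[OF cos_seq_antimono cos_seq_0, of "dim UNIV" 1 i] by simp
  then show ?thesis using cos_seq_le_1[of i] by simp
qed

text \<open>The count is the rank of P_X P_Z; the second equation relates it to the multiplicity of
  the cosine 1 between \<open>X\<close> and \<open>orth Z\<close>.\<close>

lemma card_cos_seq_pos_eq:
  shows "card {i. 0 < cos_seq X Z i} + dim (orth X \<inter> Z) = dim Z"
    and "card {i. 0 < cos_seq X Z i} + dim (X \<inter> orth Z) = dim X"
proof -
  show 1: "card {i. 0 < cos_seq X Z i} + dim (orth X \<inter> Z) = dim Z"
    using card_cos_seq_pos dim_ker_gram[OF X Z] by linarith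
  show "card {i. 0 < cos_seq X Z i} + dim (X \<inter> orth Z) = dim X"
    using 1 dim_orth_inter_orth[OF subspace_orth_set[of X] Z] dim_orth[OF X] unfolding orth_orth[OF X]
    by linarith
qed

end

end

section \<open>Weak majorization of angles\<close>

text \<open>Sorting is replaced by the choice of an index set, so that the estimates can be made for
  sums over arbitrary \<open>J\<close>.\<close>

lemma take_desc_sum_list:
  assumes "k \<le> length L"
  obtains J where "J \<subseteq> {..<length L}" "card J = k" "sum_list (take k (desc L)) = (\<Sum>i\<in>J. L ! i)"
proof -
  have len: "length (desc L) = length L" by (simp add: desc_def)
  have "mset (desc L) = mset L" by (simp add: desc_def)
  then obtain p where p: "p permutes {..<length L}" "permute_list p L = desc L"
    using mset_eq_permutation by blast
  have inj: "inj_on p {..<k}" using p(1) by (meson inj_on_subset permutes_inj subset_UNIV)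
  have "p i < length L" if "i < k" for i
    using permutes_in_image[OF p(1), of i] that assms by simp
  then have "p ` {..<k} \<subseteq> {..<length L}" by auto
  moreover have "card (p ` {..<k}) = k" using inj by (simp add: card_image)
  moreover have "sum_list (take k (desc L)) = (\<Sum>i\<in>p ` {..<k}. L ! i)"
  proof -
    have "sum_list (take k (desc L)) = (\<Sum>i<k. desc L ! i)"
      using assms len by (simp add: sum_list_sum_nth min_def atLeast0LessThan)
    also have "\<dots> = (\<Sum>i<k. L ! p i)"
      using assms by (intro sum.cong refl) (simp add: permute_list_nth[OF p(1)] flip: p(2))
    also have "\<dots> = (\<Sum>i\<in>p ` {..<k}. L ! i)" using inj by (simp add: sum.reindex)
    finally show ?thesis .
  qed
  ultimately show ?thesis by (rule that)
qed

lemma weakly_majorizedI: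
  assumes len: "length x \<le> length y"
    and y: "sorted y" "\<And>i. i < length y \<Longrightarrow> 0 \<le> y ! i"
    and le: "\<And>J. J \<subseteq> {..<length x} \<Longrightarrow> (\<Sum>i\<in>J. x ! i) \<le> (\<Sum>i<card J. rev y ! i)"
  shows "x \<prec>\<^sub>w y"
proof -
  let ?n = "length y"
  have "sum_list (take k (desc (pad ?n x))) \<le> sum_list (take k (desc (pad ?n y)))" if k: "k \<le> ?n" for k
  proof -
    have lx: "length (pad ?n x) = ?n" using len by (simp add: pad_def)
    obtain J where J: "J \<subseteq> {..<?n}" "card J = k"
      and sum: "sum_list (take k (desc (pad ?n x))) = (\<Sum>i\<in>J. pad ?n x ! i)"
      using take_desc_sum_list[of k "pad ?n x"] k unfolding lx by metis
    have fin: "finite J" using J(1) finite_subset by blast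
    let ?J = "J \<inter> {..<length x}"
    have "pad ?n x ! i = (if i < length x then x ! i else 0)" if "i < ?n" for i
      using that by (auto simp: pad_def nth_append)
    then have "(\<Sum>i\<in>J. pad ?n x ! i) = (\<Sum>i\<in>?J. x ! i)"
      using J(1) fin by (intro sum.mono_neutral_cong_right) (auto simp: subset_iff)
    also have "\<dots> \<le> (\<Sum>i<card ?J. rev y ! i)" by (intro le) auto
    \<comment> \<open>\<open>J\<close> may contain padding indices, where \<open>x\<close>
      contributes 0; the right side gains nonnegative terms instead.\<close>
    also have "\<dots> \<le> (\<Sum>i<k. rev y ! i)"
    proof (rule sum_mono2)
      show "{..<card ?J} \<subseteq> {..<k}" using card_mono[OF fin, of ?J] J(2) by auto
      show "0 \<le> rev y ! i" if "i \<in> {..<k} - {..<card ?J}" for i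
      proof -
        have i: "i < ?n" using that k by auto
        then show ?thesis using y(2)[of "?n - Suc i"] by (simp add: rev_nth)
      qed
    qed simp
    also have "\<dots> = sum_list (take k (rev y))"
      using k by (simp add: sum_list_sum_nth min_def atLeast0LessThan)
    also have "rev y = desc (pad ?n y)"
      using y(1) by (simp add: desc_def pad_def sorted_sort_id)
    finally show ?thesis unfolding sum .
  qed
  then show ?thesis
    using len by (simp add: weakly_majorized_def Let_def max_def)
qed

section \<open>From the eigenvalue inequality to the angles\<close>

context ip_space
begin

lemma sum_abs_cos_seq_diff_le:
  assumes X: "subspace X" and Y: "subspace Y" and W: "subspace W"
    and dim: "dim X = dim Y" and J: "finite J"
  shows "(\<Sum>i\<in>J. \<bar>cos_seq X W i - cos_seq Y W i\<bar>) \<le> (\<Sum>i<card J. cos_seq X (orth Y) i)"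
proof -
  let ?n = "dim UNIV"
  let ?cX = "cos_seq X W" and ?cY = "cos_seq Y W"
  obtain e l where esX: "eigsys (proj_sum X W) e l" using spectral[OF self_adj_proj_sum[OF X W]] .
  obtain f m where esY: "eigsys (proj_sum Y W) f m" using spectral[OF self_adj_proj_sum[OF Y W]] .
  obtain g d where esD: "eigsys (proj_sum X (orth Y)) g d"
    using spectral[OF self_adj_proj_sum[OF X subspace_orth_set]] .
  have "(\<lambda>v. proj_sum X W v - proj_sum Y W v) = proj_sum X (orth Y)"
    by (simp add: proj_sum_def proj_orth[OF Y] fun_eq_iff)
  then have esD': "eigsys (\<lambda>v. proj_sum X W v - proj_sum Y W v) g d" using esD by simp
  \<comment> \<open>The shifts of \<open>neg_part_proj_sum\<close>, by \<open>dim\<close> the same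
    for \<open>Y\<close>; \<open>h\<close> carries the index of a cosine to its index at the
    negative end.\<close>
  define a where "a = dim X + dim W - ?n"
  define b where "b = ?n - (dim X + dim W)"
  define h where "h i = i - a + b" for i
  \<comment> \<open>Ties belong to \<open>?P\<close>, so the indices below \<open>a\<close>, where
    both cosines are 1, never have to be looked up at the negative end.\<close>
  let ?P = "{i\<in>J. ?cY i \<le> ?cX i}" and ?N = "{i\<in>J. ?cX i < ?cY i}"
  have a: "a \<le> i" if "i \<in> ?N" for i
  proof (rule ccontr)
    assume "\<not> a \<le> i"
    then have "?cX i = 1" "?cY i = 1"
      using cos_seq_eq_1[OF X W, of i] cos_seq_eq_1[OF Y W, of i] dim by (simp_all only: a_def not_le)
    then show False using that by simp
  qed
  have negX: "neg_part ?n l (h i) = ?cX i" and negY: "neg_part ?n m (h i) = ?cY i" if "i \<in> ?N" for i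
    using neg_part_proj_sum[OF X W esX, of "i - a"] neg_part_proj_sum[OF Y W esY, of "i - a"] a[OF that]
    unfolding dim[symmetric] a_def[symmetric] b_def[symmetric] by (simp_all add: h_def)
  have inj: "inj_on h ?N"
  proof (rule inj_onI)
    fix i j assume "i \<in> ?N" "j \<in> ?N" "h i = h j"
    then show "i = j" using a[of i] a[of j] by (simp add: h_def)
  qed
  have Jsplit: "J = ?P \<union> ?N" "?P \<inter> ?N = {}" by auto
  have fin: "finite ?P" "finite ?N" using J by auto
  have "(\<Sum>i\<in>J. \<bar>?cX i - ?cY i\<bar>) = (\<Sum>i\<in>?P. \<bar>?cX i - ?cY i\<bar>) + (\<Sum>i\<in>?N. \<bar>?cX i - ?cY i\<bar>)"
    using sum.union_disjoint[OF fin Jsplit(2), of "\<lambda>i. \<bar>?cX i - ?cY i\<bar>"] Jsplit(1) by simp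
  also have "(\<Sum>i\<in>?P. \<bar>?cX i - ?cY i\<bar>) = (\<Sum>i\<in>?P. pos_part ?n l i - pos_part ?n m i)"
    unfolding pos_part_proj_sum[OF X W esX] pos_part_proj_sum[OF Y W esY] by (intro sum.cong) auto
  also have "(\<Sum>i\<in>?N. \<bar>?cX i - ?cY i\<bar>) = (\<Sum>i\<in>?N. neg_part ?n m (h i) - neg_part ?n l (h i))"
    using negX negY by (intro sum.cong refl) auto
  also have "\<dots> = (\<Sum>i\<in>h ` ?N. neg_part ?n m i - neg_part ?n l i)"
    using inj by (simp add: sum.reindex)
  also have "(\<Sum>i\<in>?P. pos_part ?n l i - pos_part ?n m i) + \<dots>
      \<le> (\<Sum>i<card ?P + card (h ` ?N). pos_part ?n d i)"
    using fin by (intro lidskii[OF self_adj_proj_sum[OF Y W] esX esY esD']) auto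
  also have "card ?P + card (h ` ?N) = card J"
    using card_Un_disjoint[OF fin Jsplit(2)] Jsplit(1) inj by (simp add: card_image)
  also have "pos_part ?n d = cos_seq X (orth Y)"
    by (rule pos_part_proj_sum[OF X subspace_orth_set esD])
  finally show ?thesis .
qed

context
  fixes X Z
  assumes X: "subspace X" and Z: "subspace Z"
begin

lemma length_principal_angles: "length (principal_angles X Z) = min (dim X) (dim Z)"
proof -
  have "dim X \<le> dim UNIV" by (rule dim_subset) simp
  then show ?thesis unfolding principal_angles_def length_map length_take length_singular_values[OF X Z] by simp
qed

lemma nth_principal_angles:
  assumes "i < min (dim X) (dim Z)"
  shows "principal_angles X Z ! i = arccos (cos_seq X Z i)"
proof -
  have "i < length (principal_angles X Z)" using assms length_principal_angles by simp
  then have "i < length (singular_values (proj X \<circ> proj Z))" by (simp add: principal_angles_def)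
  then show ?thesis using assms by (simp add: principal_angles_def cos_seq_def Let_def)
qed

lemma cos_principal_angles:
  "map cos (principal_angles X Z) = map (cos_seq X Z) [0..<min (dim X) (dim Z)]"
proof (rule nth_equalityI)
  fix i assume "i < length (map cos (principal_angles X Z))"
  then have i: "i < min (dim X) (dim Z)" by (simp only: length_map length_principal_angles)
  have "cos (arccos (cos_seq X Z i)) = cos_seq X Z i"
    using cos_seq_nonneg[OF X Z, of i] cos_seq_le_1[OF X Z, of i] by (intro cos_arccos) linarith+
  then show "map cos (principal_angles X Z) ! i = map (cos_seq X Z) [0..<min (dim X) (dim Z)] ! i"
    using i by (simp add: length_principal_angles nth_principal_angles)
qed (simp add: length_principal_angles)

text \<open>The nonzero sines of the angles with \<open>Z\<close> are cosines of the angles with the complement of \<open>Z\<close>,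
  which additionally contain \<open>dim X - min (dim X) (dim Z)\<close> ones.\<close>

lemma sin_arccos_cos_seq:
  defines "k \<equiv> min (dim X) (dim Z)"
  assumes i: "i < k"
  shows "sin (arccos (cos_seq X Z i)) = cos_seq X (orth Z) (dim X - Suc i)"
proof -
  define n where "n = dim UNIV"
  define r where "r = card {i. 0 < cos_seq X Z i}"
  let ?g = "cos_seq X (orth Z)"
  note c = cos_seq_antimono[OF X Z] cos_seq_nonneg[OF X Z] cos_seq_le_1[OF X Z]
  note g = cos_seq_antimono[OF X subspace_orth_set] cos_seq_nonneg[OF X subspace_orth_set]
    cos_seq_le_1[OF X subspace_orth_set] cos_seq_0[OF X subspace_orth_set]
  have kn: "k \<le> n" unfolding n_def k_def using dim_subset[of X UNIV] by simp
  have r: "r + dim (X \<inter> orth Z) = dim X" "r \<le> k"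
    using card_cos_seq_pos_eq[OF X Z] by (simp_all add: r_def k_def)
  have pos: "0 < cos_seq X Z j \<longleftrightarrow> j < r" for j
  proof
    assume j: "0 < cos_seq X Z j"
    have "i < n" if "0 < cos_seq X Z i" for i
      using that cos_seq_0[OF X Z, of i] unfolding n_def by (cases "i < dim UNIV") linarith+
    then have "{i. 0 < cos_seq X Z i} \<subseteq> {..<n}" by auto
    then have fin: "finite {i. 0 < cos_seq X Z i}" by (rule finite_subset) simp
    have "{..j} \<subseteq> {i. 0 < cos_seq X Z i}" using j antimonoD[OF c(1)] by (auto intro: less_le_trans)
    then show "j < r" using card_mono[OF fin, of "{..j}"] by (simp add: r_def)
  next
    assume j: "j < r"
    show "0 < cos_seq X Z j"
    proof (rule ccontr)
      assume "\<not> 0 < cos_seq X Z j"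
      then have "i < j" if "0 < cos_seq X Z i" for i
        using that antimonoD[OF c(1), of j i] by (cases "i < j") linarith+
      then have "{i. 0 < cos_seq X Z i} \<subseteq> {..<j}" by auto
      then have "r \<le> card {..<j}" unfolding r_def by (intro card_mono) auto
      then show False using j by simp
    qed
  qed
  \<comment> \<open>The sines in reversed order, hence nonincreasing, and padded by zeros like
    \<open>?g\<close>.\<close>
  define f where "f j = (if j < k then sqrt (1 - (cos_seq X Z (k - Suc j))\<^sup>2) else 0)" for j
  have sq1: "(cos_seq X Z j)\<^sup>2 \<le> 1" for j using c(2,3)[of j] by (simp add: power_le_one)
  have cardf: "card {j. f j = s} = card {j. j < k \<and> cos_seq X Z j = sqrt (1 - s\<^sup>2)}" if s: "0 < s" "s \<le> 1" for s
  proof (rule bij_betw_same_card[of "\<lambda>j. k - Suc j"])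
    have s2: "s\<^sup>2 \<le> 1" using s by (simp add: power_le_one)
    have iff: "sqrt (1 - (cos_seq X Z j)\<^sup>2) = s \<longleftrightarrow> cos_seq X Z j = sqrt (1 - s\<^sup>2)" for j
    proof
      assume "sqrt (1 - (cos_seq X Z j)\<^sup>2) = s"
      then have "s\<^sup>2 = 1 - (cos_seq X Z j)\<^sup>2" using sq1[of j] by auto
      then show "cos_seq X Z j = sqrt (1 - s\<^sup>2)" using c(2)[of j] by simp
    next
      assume "cos_seq X Z j = sqrt (1 - s\<^sup>2)"
      then have "(cos_seq X Z j)\<^sup>2 = 1 - s\<^sup>2" using s2 by simp
      then show "sqrt (1 - (cos_seq X Z j)\<^sup>2) = s" using s(1) by simp
    qed
    have "f j = s \<longleftrightarrow> j < k \<and> cos_seq X Z (k - Suc j) = sqrt (1 - s\<^sup>2)" for j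
      using s(1) iff[of "k - Suc j"] unfolding f_def by (cases "j < k") (simp_all only: if_True if_False, auto)
    moreover have "bij_betw (\<lambda>j. k - Suc j) {j. j < k \<and> cos_seq X Z (k - Suc j) = t}
        {j. j < k \<and> cos_seq X Z j = t}" for t
      by (rule bij_betw_byWitness[where f' = "\<lambda>j. k - Suc j"]) auto
    ultimately show "bij_betw (\<lambda>j. k - Suc j) {j. f j = s} {j. j < k \<and> cos_seq X Z j = sqrt (1 - s\<^sup>2)}"
      by (simp only:)
  qed
  \<comment> \<open>\<open>?g\<close> starts with \<open>dim X - k\<close> additional ones, so each
    sine is found that much further on.\<close>
  have "f (k - Suc i + 0) = ?g (k - Suc i + (dim X - k))"
  proof (rule antimono_shift_eq[where N = n])
    show "antimono f"
    proof (rule antimonoI)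
      fix p q :: nat assume pq: "p \<le> q"
      have "cos_seq X Z (k - Suc p) \<le> cos_seq X Z (k - Suc q)"
        using pq by (intro antimonoD[OF c(1)]) simp
      then have "(cos_seq X Z (k - Suc p))\<^sup>2 \<le> (cos_seq X Z (k - Suc q))\<^sup>2"
        using c(2) by (intro power_mono) auto
      then show "f q \<le> f p" using pq sq1 by (auto simp: f_def)
    qed
    show "f j = 0" if "n \<le> j" for j using that kn by (simp add: f_def)
    show "f j \<le> 1" "0 \<le> f j" for j using sq1 by (simp_all add: f_def)
    show "?g j = 0" if "n \<le> j" for j using g(4) that by (simp only: n_def)
    show "card {j. f j = s} = card {j. ?g j = s}" if s: "0 < s" "s < 1" for s
    proof -
      have t: "0 < 1 - s\<^sup>2" using s by (simp add: power_less_one_iff abs_square_less_1)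
      then have t': "0 < sqrt (1 - s\<^sup>2)" by simp
      \<comment> \<open>Restricting to \<open>j < k\<close> loses nothing, since positive cosines
        occur only below \<open>r \<le> k\<close>.\<close>
      have "{j. j < k \<and> cos_seq X Z j = sqrt (1 - s\<^sup>2)} = {j. cos_seq X Z j = sqrt (1 - s\<^sup>2)}"
        using pos r(2) t' by (metis (mono_tags) less_le_trans)
      then have "card {j. f j = s} = card {j. cos_seq X Z j = sqrt (1 - s\<^sup>2)}"
        using cardf[of s] s by simp
      also have "\<dots> = dim {v. gram X Z v = scale (of_real (1 - s\<^sup>2)) v}"
        using card_cos_seq[OF X Z t'] real_sqrt_pow2[of "1 - s\<^sup>2"] t by (simp only: less_imp_le)
      also have "\<dots> = card {j. ?g j = s}"
        using card_cos_seq[OF X subspace_orth_set s(1), of Z] dim_eigenspace_gram_orth[OF X Z s] by (simp only:)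
      finally show ?thesis .
    qed
    \<comment> \<open>Sines equal to 1 belong to vanishing cosines, that is, to the
      \<open>k - r\<close> indices from \<open>r\<close> on; against the \<open>dim X - r\<close>
      ones of \<open>?g\<close> this leaves the shift \<open>dim X - k\<close>.\<close>
    have "cos_seq X Z j = sqrt (1 - 1\<^sup>2) \<longleftrightarrow> r \<le> j" for j
      using pos[of j] c(2)[of j] by (simp add: le_less_linear) linarith
    then have "{j. j < k \<and> cos_seq X Z j = sqrt (1 - 1\<^sup>2)} = {r..<k}"
      by (simp only: atLeastLessThan_def atLeast_def lessThan_def Int_def mem_Collect_eq conj_commute)
    then have "card {j. f j = 1} = k - r" using cardf[of 1] by (simp only: card_atLeastLessThan zero_less_one order_refl)
    moreover have "card {j. ?g j = 1} = dim (X \<inter> orth Z)"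
      by (rule card_cos_seq_1[OF X subspace_orth_set])
    moreover have "k \<le> dim X" by (simp add: k_def)
    ultimately show "card {j. f j = 1} + (dim X - k) = card {j. ?g j = 1} + 0" using r by linarith
  qed (use g in auto)
  moreover have "k - Suc i + (dim X - k) = dim X - Suc i"
    using i by (simp add: k_def)
  moreover have "f (k - Suc i) = sin (arccos (cos_seq X Z i))"
    using i c(2,3)[of i] by (simp add: f_def sin_arccos)
  ultimately show ?thesis by simp
qed

lemma sin_principal_angles:
  "map sin (principal_angles X Z)
    = map (\<lambda>i. cos_seq X (orth Z) (dim X - Suc i)) [0..<min (dim X) (dim Z)]"
  by (intro nth_equalityI)
    (auto simp: length_principal_angles nth_principal_angles sin_arccos_cos_seq)

end

theorem abs_diff_principal_angles_weakly_majorized: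
  assumes X: "subspace X" and Y: "subspace Y" and Z: "subspace Z" and dim: "dim X = dim Y"
  shows "abs_diff (map sin (principal_angles X Z)) (map sin (principal_angles Y Z))
      \<prec>\<^sub>w map sin (principal_angles X Y)"
    and "abs_diff (map cos (principal_angles X Z)) (map cos (principal_angles Y Z))
      \<prec>\<^sub>w map sin (principal_angles X Y)"
proof -
  let ?p = "dim X" and ?k = "min (dim X) (dim Z)"
  let ?s = "cos_seq X (orth Y)"
  \<comment> \<open>By \<open>dim\<close> there are \<open>dim X\<close> angles; they are
    nondecreasing, so \<open>?s\<close> appears reversed.\<close>
  have y: "map sin (principal_angles X Y) = map (\<lambda>i. ?s (?p - Suc i)) [0..<?p]"
    using sin_principal_angles[OF X Y] dim by simp
  have maj: "x \<prec>\<^sub>w map sin (principal_angles X Y)"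
    if len: "length x \<le> ?p" and le: "\<And>J. J \<subseteq> {..<length x} \<Longrightarrow> (\<Sum>i\<in>J. x ! i) \<le> (\<Sum>i<card J. ?s i)" for x
    unfolding y
  proof (rule weakly_majorizedI)
    show "sorted (map (\<lambda>i. ?s (?p - Suc i)) [0..<?p])"
      unfolding sorted_iff_nth_mono using antimonoD[OF cos_seq_antimono[OF X subspace_orth_set]] by simp
    fix J assume J: "J \<subseteq> {..<length x}"
    then have "card J \<le> ?p" using card_mono[of "{..<length x}" J] len by simp
    then have "(\<Sum>i<card J. ?s i) = (\<Sum>i<card J. rev (map (\<lambda>i. ?s (?p - Suc i)) [0..<?p]) ! i)"
      by (intro sum.cong) (auto simp: rev_nth)
    then show "(\<Sum>i\<in>J. x ! i) \<le> (\<Sum>i<card J. rev (map (\<lambda>i. ?s (?p - Suc i)) [0..<?p]) ! i)"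
      using le[OF J] by simp
  qed (use len cos_seq_nonneg[OF X subspace_orth_set] in auto)
  show "abs_diff (map cos (principal_angles X Z)) (map cos (principal_angles Y Z))
      \<prec>\<^sub>w map sin (principal_angles X Y)"
  proof (rule maj)
    let ?x = "abs_diff (map cos (principal_angles X Z)) (map cos (principal_angles Y Z))"
    have x: "?x = map (\<lambda>i. \<bar>cos_seq X Z i - cos_seq Y Z i\<bar>) [0..<?k]"
      unfolding cos_principal_angles[OF X Z] cos_principal_angles[OF Y Z] dim abs_diff_def
      by (intro nth_equalityI) auto
    show "length ?x \<le> ?p" unfolding x by simp
    fix J assume "J \<subseteq> {..<length ?x}"
    then have J: "J \<subseteq> {..<?k}" unfolding x by simp
    then have "finite J" using finite_subset by blast
    have "(\<Sum>i\<in>J. ?x ! i) = (\<Sum>i\<in>J. \<bar>cos_seq X Z i - cos_seq Y Z i\<bar>)"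
      unfolding x using J by (intro sum.cong) auto
    also have "\<dots> \<le> (\<Sum>i<card J. ?s i)"
      by (rule sum_abs_cos_seq_diff_le[OF X Y Z dim \<open>finite J\<close>])
    finally show "(\<Sum>i\<in>J. ?x ! i) \<le> (\<Sum>i<card J. ?s i)" .
  qed
  show "abs_diff (map sin (principal_angles X Z)) (map sin (principal_angles Y Z))
      \<prec>\<^sub>w map sin (principal_angles X Y)"
  proof (rule maj)
    let ?x = "abs_diff (map sin (principal_angles X Z)) (map sin (principal_angles Y Z))"
    \<comment> \<open>Sines read \<open>cos_seq\<close> backwards from the dimension, and
      \<open>dim\<close> makes the reflected index the same for \<open>X\<close> and
      \<open>Y\<close>. The bound depends only on \<open>card J\<close>, so reflecting
      \<open>J\<close> does not change it.\<close>
    let ?h = "\<lambda>i. ?p - Suc i"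
    let ?d = "\<lambda>i. \<bar>cos_seq X (orth Z) i - cos_seq Y (orth Z) i\<bar>"
    have x: "?x = map (\<lambda>i. ?d (?h i)) [0..<?k]"
      unfolding sin_principal_angles[OF X Z] sin_principal_angles[OF Y Z] dim abs_diff_def
      by (intro nth_equalityI) auto
    show "length ?x \<le> ?p" unfolding x by simp
    fix J assume "J \<subseteq> {..<length ?x}"
    then have J: "J \<subseteq> {..<?k}" unfolding x by simp
    then have fin: "finite J" using finite_subset by blast
    have inj: "inj_on ?h J"
    proof (rule inj_onI)
      fix i j assume "i \<in> J" "j \<in> J" and eq: "?h i = ?h j"
      then have "i < ?p" "j < ?p" using J by auto
      then show "i = j" using eq by linarith
    qed
    have "(\<Sum>i\<in>J. ?x ! i) = (\<Sum>i\<in>J. ?d (?h i))"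
      unfolding x using J by (intro sum.cong) auto
    also have "\<dots> = sum ?d (?h ` J)" using inj by (simp add: sum.reindex)
    also have "\<dots> \<le> (\<Sum>i<card (?h ` J). ?s i)"
      using fin by (intro sum_abs_cos_seq_diff_le X Y subspace_orth_set dim) simp
    also have "card (?h ` J) = card J" using inj by (rule card_image)
    finally show "(\<Sum>i\<in>J. ?x ! i) \<le> (\<Sum>i<card J. ?s i)" .
  qed
qed

end

theorem theorem3p2:
  fixes scale :: "'k :: rc_scalar \<Rightarrow> 'v :: ab_group_add \<Rightarrow> 'v"
    and ip :: "'v \<Rightarrow> 'v \<Rightarrow> 'k"
    and X Y Z :: "'v set"
  assumes "ip_space scale ip"
    and "module.subspace scale X" and "module.subspace scale Y" and "module.subspace scale Z"
    and "vector_space.dim scale X = vector_space.dim scale Y"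
  shows "abs_diff (map sin (ip_space.principal_angles scale ip X Z))
                  (map sin (ip_space.principal_angles scale ip Y Z))
           \<prec>\<^sub>w map sin (ip_space.principal_angles scale ip X Y)
       \<and> abs_diff (map cos (ip_space.principal_angles scale ip X Z))
                  (map cos (ip_space.principal_angles scale ip Y Z))
           \<prec>\<^sub>w map sin (ip_space.principal_angles scale ip X Y)"
proof -
  interpret ip_space scale ip by fact
  show ?thesis
    using abs_diff_principal_angles_weakly_majorized[OF assms(2-5)] by blast
qed

end
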